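(* Let $n\ge 2$. The fixed-point algebra $\mathcal{O}_n^{\lambda_C}=\{x\in\mathcal{O}_n : \lambda_C(x)=x\}$ of the Cuntz algebra $\mathcal{O}_n$ under the cyclic automorphism $\lambda_C$ is $*$-isomorphic with $\mathcal{O}_n$. Moreover, $\mathcal{O}_n^{\lambda_C}$ is generated (as a $C^*$-algebra) by the elements $\mathrm{Ad}(v^l)(T)=v^l T (v^l)^*$, $l=0,1,\ldots,n-1$, where $$T=\frac{1}{\sqrt n}\sum_{k=1}^n S_k,\qquad v=\sum_{k=1}^n e^{2\pi k i/n}S_kS_k^*.$$
   Context: $\mathcal{O}_n$ is the Cuntz algebra: the universal $C^*$-algebra generated by $n$ isometries $S_1,\ldots,S_n$ such that $\sum_{k=1}^n S_kS_k^*=1$. The cyclic automorphism $\lambda_C$ of $\mathcal{O}_n$ is the $*$-automorphism determined by $\lambda_C(S_k)=S_{k+1}$ for $k=1,\ldots,n-1$ and $\lambda_C(S_n)=S_1$. In the exponentials, $i$ is the imaginary unit. *)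

theory Defs
  imports
    Complex_Main
    "HOL-Algebra.QuotRing"
    "HOL-Algebra.Module"
    "HOL-Algebra.Algebraic_Closure_Type"
begin

section \<open>Unital C*-algebras on carrier sets\<close>

record 'a cstar_algebra = "(complex, 'a) Module.module" +
  star :: "'a \<Rightarrow> 'a"
  cnorm :: "'a \<Rightarrow> real"

definition norm_tendsto :: "'a cstar_algebra \<Rightarrow> (nat \<Rightarrow> 'a) \<Rightarrow> 'a \<Rightarrow> bool" where
  "norm_tendsto A s L \<longleftrightarrow> (\<lambda>m. cnorm A (s m \<ominus>\<^bsub>A\<^esub> L)) \<longlonglongrightarrow> 0"

definition norm_Cauchy :: "'a cstar_algebra \<Rightarrow> (nat \<Rightarrow> 'a) \<Rightarrow> bool" where
  "norm_Cauchy A s \<longleftrightarrow>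
     (\<forall>e>0. \<exists>N. \<forall>p\<ge>N. \<forall>q\<ge>N. cnorm A (s p \<ominus>\<^bsub>A\<^esub> s q) < e)"

text \<open>
  The zero algebra is admitted. \<^const>\<open>ring_of_type_algebra\<close> is here the field of complex numbers;
  the library locale for algebras over a ring is not usable, as it requires commutativity.
\<close>

locale unital_cstar_algebra = ring A for A :: "'a cstar_algebra" (structure) +
  assumes complex_vector_space:
      "Module.module (ring_of_type_algebra :: complex ring) A"
    and smult_mult_left:
      "\<lbrakk>x \<in> carrier A; y \<in> carrier A\<rbrakk> \<Longrightarrow> (c \<odot> x) \<otimes> y = c \<odot> (x \<otimes> y)"
    and smult_mult_right:
      "\<lbrakk>x \<in> carrier A; y \<in> carrier A\<rbrakk> \<Longrightarrow> x \<otimes> (c \<odot> y) = c \<odot> (x \<otimes> y)"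
    and star_closed: "x \<in> carrier A \<Longrightarrow> star A x \<in> carrier A"
    and star_star: "x \<in> carrier A \<Longrightarrow> star A (star A x) = x"
    and star_add:
      "\<lbrakk>x \<in> carrier A; y \<in> carrier A\<rbrakk> \<Longrightarrow> star A (x \<oplus> y) = star A x \<oplus> star A y"
    and star_smult: "x \<in> carrier A \<Longrightarrow> star A (c \<odot> x) = cnj c \<odot> star A x"
    and star_mult:
      "\<lbrakk>x \<in> carrier A; y \<in> carrier A\<rbrakk> \<Longrightarrow> star A (x \<otimes> y) = star A y \<otimes> star A x"
    and norm_nonneg: "x \<in> carrier A \<Longrightarrow> 0 \<le> cnorm A x"
    and norm_eq_zero_iff: "x \<in> carrier A \<Longrightarrow> cnorm A x = 0 \<longleftrightarrow> x = \<zero>"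
    and norm_triangle:
      "\<lbrakk>x \<in> carrier A; y \<in> carrier A\<rbrakk> \<Longrightarrow> cnorm A (x \<oplus> y) \<le> cnorm A x + cnorm A y"
    and norm_smult: "x \<in> carrier A \<Longrightarrow> cnorm A (c \<odot> x) = cmod c * cnorm A x"
    and norm_mult_le:
      "\<lbrakk>x \<in> carrier A; y \<in> carrier A\<rbrakk> \<Longrightarrow> cnorm A (x \<otimes> y) \<le> cnorm A x * cnorm A y"
    and cstar_identity: "x \<in> carrier A \<Longrightarrow> cnorm A (star A x \<otimes> x) = (cnorm A x)\<^sup>2"
    and norm_complete:
      "\<lbrakk>\<And>m::nat. s m \<in> carrier A; norm_Cauchy A s\<rbrakk> \<Longrightarrow> \<exists>L\<in>carrier A. norm_tendsto A s L"

text \<open>A C*-subalgebra need not contain the unit of the ambient algebra.\<close>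

definition cstar_subalgebra :: "'a cstar_algebra \<Rightarrow> 'a set \<Rightarrow> bool" where
  "cstar_subalgebra A B \<longleftrightarrow>
     B \<subseteq> carrier A \<and> \<zero>\<^bsub>A\<^esub> \<in> B \<and>
     (\<forall>x\<in>B. \<forall>y\<in>B. x \<oplus>\<^bsub>A\<^esub> y \<in> B \<and> x \<otimes>\<^bsub>A\<^esub> y \<in> B) \<and>
     (\<forall>x\<in>B. star A x \<in> B \<and> (\<forall>c. c \<odot>\<^bsub>A\<^esub> x \<in> B)) \<and>
     (\<forall>s L. (\<forall>m. s m \<in> B) \<and> L \<in> carrier A \<and> norm_tendsto A s L \<longrightarrow> L \<in> B)"

definition cstar_generated :: "'a cstar_algebra \<Rightarrow> 'a set \<Rightarrow> 'a set" where
  "cstar_generated A G = \<Inter>{B. cstar_subalgebra A B \<and> G \<subseteq> B}"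

definition star_hom :: "'a cstar_algebra \<Rightarrow> 'b cstar_algebra \<Rightarrow> ('a \<Rightarrow> 'b) set" where
  "star_hom A B = {h \<in> ring_hom A B. \<forall>x\<in>carrier A.
     h (star A x) = star B (h x) \<and> (\<forall>c. h (c \<odot>\<^bsub>A\<^esub> x) = c \<odot>\<^bsub>B\<^esub> h x)}"

definition star_iso :: "'a cstar_algebra \<Rightarrow> 'b cstar_algebra \<Rightarrow> ('a \<Rightarrow> 'b) set" where
  "star_iso A B = star_hom A B \<inter> ring_iso A B"

definition star_isomorphic :: "'a cstar_algebra \<Rightarrow> 'b cstar_algebra \<Rightarrow> bool" where
  "star_isomorphic A B \<longleftrightarrow> star_iso A B \<noteq> {}"

definition fixed_point_algebra :: "'a cstar_algebra \<Rightarrow> ('a \<Rightarrow> 'a) \<Rightarrow> 'a cstar_algebra" where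
  "fixed_point_algebra A h = A\<lparr>carrier := {x \<in> carrier A. h x = x}\<rparr>"

definition Ad :: "'a cstar_algebra \<Rightarrow> 'a \<Rightarrow> 'a \<Rightarrow> 'a" where
  "Ad A u x = u \<otimes>\<^bsub>A\<^esub> x \<otimes>\<^bsub>A\<^esub> star A u"


section \<open>The Cuntz algebra\<close>

text \<open>Families are indexed by \<open>1, \<dots>, n\<close>; the values of \<open>S\<close> at other indices are irrelevant.\<close>

definition cuntz_family :: "'a cstar_algebra \<Rightarrow> nat \<Rightarrow> (nat \<Rightarrow> 'a) \<Rightarrow> bool" where
  "cuntz_family A n S \<longleftrightarrow>
     (\<forall>k\<in>{1..n}. S k \<in> carrier A \<and> star A (S k) \<otimes>\<^bsub>A\<^esub> S k = \<one>\<^bsub>A\<^esub>) \<and>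
     (\<Oplus>\<^bsub>A\<^esub>k\<in>{1..n}. S k \<otimes>\<^bsub>A\<^esub> star A (S k)) = \<one>\<^bsub>A\<^esub>"

text \<open>
  \<open>A\<close> is the universal C*-algebra generated by isometries \<open>S 1, \<dots>, S n\<close> whose range projections
  sum to the unit.

  The test algebras \<open>B\<close> range over the C*-algebras whose carrier is a set of elements of the type
  \<open>'a\<close>. This is no restriction: it suffices to test on C*-algebras generated by \<open>n\<close> elements, these
  have at most continuum many elements, and \<open>'a\<close> has at least continuum many because \<open>A\<close> is a
  nonzero complex vector space. So every such algebra has an isomorphic copy among the \<open>B\<close>.
  The condition \<open>\<one> \<noteq> \<zero>\<close>, which the universal algebra satisfies since there is a nonzero algebra
  with such a family, is there only to exclude that \<open>'a\<close> is too small, e.g. a singleton, in which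
  case the zero algebra would pass the test.
\<close>

definition cuntz_algebra :: "'a cstar_algebra \<Rightarrow> nat \<Rightarrow> (nat \<Rightarrow> 'a) \<Rightarrow> bool" where
  "cuntz_algebra A n S \<longleftrightarrow>
     unital_cstar_algebra A \<and> \<one>\<^bsub>A\<^esub> \<noteq> \<zero>\<^bsub>A\<^esub> \<and>
     cuntz_family A n S \<and>
     cstar_generated A (S ` {1..n}) = carrier A \<and>
     (\<forall>(B :: 'a cstar_algebra) R. unital_cstar_algebra B \<and> cuntz_family B n R \<longrightarrow>
        (\<exists>h\<in>star_hom A B. \<forall>k\<in>{1..n}. h (S k) = R k))"

text \<open>On the carrier of a Cuntz algebra, this determines \<open>h\<close>, as the \<open>S k\<close> generate it.\<close>

definition cyclic_automorphism ::
    "'a cstar_algebra \<Rightarrow> nat \<Rightarrow> (nat \<Rightarrow> 'a) \<Rightarrow> ('a \<Rightarrow> 'a) \<Rightarrow> bool" where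
  "cyclic_automorphism A n S h \<longleftrightarrow>
     h \<in> star_iso A A \<and> (\<forall>k\<in>{1..n-1}. h (S k) = S (k + 1)) \<and> h (S n) = S 1"

definition cuntz_T :: "'a cstar_algebra \<Rightarrow> nat \<Rightarrow> (nat \<Rightarrow> 'a) \<Rightarrow> 'a" where
  "cuntz_T A n S = complex_of_real (1 / sqrt (real n)) \<odot>\<^bsub>A\<^esub> (\<Oplus>\<^bsub>A\<^esub>k\<in>{1..n}. S k)"

definition cuntz_v :: "'a cstar_algebra \<Rightarrow> nat \<Rightarrow> (nat \<Rightarrow> 'a) \<Rightarrow> 'a" where
  "cuntz_v A n S = (\<Oplus>\<^bsub>A\<^esub>k\<in>{1..n}.
     exp (2 * of_real pi * of_nat k * \<i> / of_nat n) \<odot>\<^bsub>A\<^esub> (S k \<otimes>\<^bsub>A\<^esub> star A (S k)))"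

end

theory Submission
  imports Defs
begin

text \<open>
  Write \<open>e m = exp (2 \<pi> i m / n)\<close> and \<open>t l = v\<^sup>l T v\<^sup>-\<^sup>l\<close>, and let \<open>B\<close> be the C*-algebra generated by
  \<open>t 1, \<dots>, t n\<close>; note that \<open>t 0 = t n\<close>, as \<open>v\<^sup>n = 1\<close>. The proof shows that \<open>B\<close> is isomorphic with the Cuntz
  algebra and that it is the fixed-point algebra.

  The family \<open>v\<^sup>l T\<close> is the discrete Fourier transform of \<open>S 1, \<dots>, S n\<close>. So it is a Cuntz family, and so
  is \<open>t\<close> (\<open>t_family\<close>). The universal property yields an endomorphism \<open>h\<close> with \<open>h (S l) = t l\<close>. To
  see that it is injective with closed range, one constructs a left inverse instead of appealing
  to the simplicity of the Cuntz algebra. The universal property provides a second endomorphism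
  \<open>\<Phi>\<close>, with \<open>\<Phi> (S k) = S k (W k)\<close> for suitable unitaries \<open>W k\<close>, such that
  \<open>\<Phi> (h x) T = T x\<close> for all \<open>x\<close> (\<open>intertwining\<close>). As \<open>T\<close> is an isometry, \<open>x = T\<^sup>* \<Phi>(h x) T\<close>. In the
  background is the crossed product of the Cuntz algebra by the cyclic permutation of its
  generators. It is represented by matrices over the Cuntz algebra, and these become elements of
  the Cuntz algebra itself by means of the matrix units \<open>S\<^sub>j S\<^sub>k\<^sup>*\<close>.

  The automorphism \<open>\<Lambda>\<close> fixes \<open>T\<close> and multiplies \<open>v\<close> by \<open>e (-1)\<close>, so it fixes all \<open>t l\<close> and hence \<open>B\<close>.
  Conversely, \<open>v\<close> and \<open>T\<close> generate the Cuntz algebra, and conjugation by \<open>v\<close> permutes the \<open>t l\<close>. So the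
  elements \<open>b v\<^sup>l\<close> with \<open>b \<in> B\<close> span a dense subalgebra. The mean over the orbits of \<open>\<Lambda>\<close> is a
  continuous projection onto the fixed-point algebra; it maps \<open>b v\<^sup>l\<close> to \<open>b\<close> if \<open>n\<close> divides \<open>l\<close>, and to
  zero otherwise, so that its range is \<open>B\<close> (\<open>orbit_sum_range\<close>, \<open>fixed_points_eq\<close>).

  Two facts of C*-algebra theory enter: homomorphisms are contractive (\<open>star_hom_contractive\<close>),
  and isometries whose range projections add up to the unit have orthogonal ranges
  (\<open>S_orthogonal\<close>). They are usually derived from the spectral radius formula and the theory of
  positive elements. Here both rest on square roots of \<open>1 - x\<close> for \<open>\<parallel>x\<parallel> < 1\<close> and on the remark that
  commuting self-adjoint elements with \<open>e\<^sup>2 + g\<^sup>2 = \<epsilon>\<close> have norm at most \<open>\<surd>\<epsilon>\<close>, since \<open>e\<close> and \<open>g\<close> are the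
  real and imaginary parts of a multiple of a unitary.
\<close>

section \<open>Elementary C*-algebra theory\<close>

context unital_cstar_algebra
begin

lemma smult_closed [simp, intro]: "x \<in> carrier A \<Longrightarrow> c \<odot> x \<in> carrier A"
  using module.smult_closed[OF complex_vector_space]
  by (simp add: ring_of_type_algebra_def)

lemma smult_add: "\<lbrakk>x \<in> carrier A; y \<in> carrier A\<rbrakk> \<Longrightarrow> c \<odot> (x \<oplus> y) = c \<odot> x \<oplus> c \<odot> y"
  using module.smult_r_distr[OF complex_vector_space]
  by (simp add: ring_of_type_algebra_def)

lemma add_smult: "x \<in> carrier A \<Longrightarrow> (c + d) \<odot> x = c \<odot> x \<oplus> d \<odot> x"
  using module.smult_l_distr[OF complex_vector_space]
  by (simp add: ring_of_type_algebra_def)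

lemma smult_smult [simp]: "x \<in> carrier A \<Longrightarrow> c \<odot> (d \<odot> x) = (c * d) \<odot> x"
  using module.smult_assoc1[OF complex_vector_space]
  by (simp add: ring_of_type_algebra_def)

lemma smult_1 [simp]: "x \<in> carrier A \<Longrightarrow> 1 \<odot> x = x"
  using module.smult_one[OF complex_vector_space]
  by (simp add: ring_of_type_algebra_def)

lemma smult_0 [simp]: "x \<in> carrier A \<Longrightarrow> 0 \<odot> x = \<zero>"
  using module.smult_l_null[OF complex_vector_space]
  by (simp add: ring_of_type_algebra_def)

lemma smult_zero [simp]: "c \<odot> \<zero> = \<zero>"
  using smult_smult[of \<zero> c 0] by simp

lemma minus_eq_smult: "x \<in> carrier A \<Longrightarrow> \<ominus> x = (-1) \<odot> x"
  using add_smult[of x "-1" 1] by (simp add: minus_equality)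

lemma diff_eq_smult: "\<lbrakk>x \<in> carrier A; y \<in> carrier A\<rbrakk> \<Longrightarrow> x \<ominus> y = x \<oplus> (-1) \<odot> y"
  by (simp add: a_minus_def minus_eq_smult)

lemma smult_diff: "\<lbrakk>x \<in> carrier A; y \<in> carrier A\<rbrakk> \<Longrightarrow> c \<odot> (x \<ominus> y) = c \<odot> x \<ominus> c \<odot> y"
  by (simp add: diff_eq_smult smult_add)

declare star_closed [simp, intro] star_star [simp] star_mult [simp] star_add [simp]
  star_smult [simp] smult_mult_left [simp] smult_mult_right [simp]

lemma star_one [simp]: "star A \<one> = \<one>"
  by (metis l_one one_closed star_closed star_mult star_star r_one)

lemma star_zero [simp]: "star A \<zero> = \<zero>"
  using star_smult[of \<zero> 0] by simp

lemma star_diff [simp]: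
  "\<lbrakk>x \<in> carrier A; y \<in> carrier A\<rbrakk> \<Longrightarrow> star A (x \<ominus> y) = star A x \<ominus> star A y"
  by (simp add: diff_eq_smult)

lemma norm_zero [simp]: "cnorm A \<zero> = 0"
  by (simp add: norm_eq_zero_iff)

lemma norm_diff_commute:
  "\<lbrakk>x \<in> carrier A; y \<in> carrier A\<rbrakk> \<Longrightarrow> cnorm A (x \<ominus> y) = cnorm A (y \<ominus> x)"
proof -
  assume xy: "x \<in> carrier A" "y \<in> carrier A"
  then have "y \<ominus> x = (-1) \<odot> (x \<ominus> y)"
    by (simp add: diff_eq_smult smult_add a_comm)
  then show ?thesis using xy by (simp add: norm_smult)
qed

lemma norm_diff_le:
  "\<lbrakk>x \<in> carrier A; y \<in> carrier A\<rbrakk> \<Longrightarrow> cnorm A (x \<ominus> y) \<le> cnorm A x + cnorm A y"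
  using norm_triangle[of x "(-1) \<odot> y"] by (simp add: diff_eq_smult norm_smult)

lemma norm_diff_triangle:
  assumes "x \<in> carrier A" "y \<in> carrier A" "z \<in> carrier A"
  shows "cnorm A (x \<ominus> z) \<le> cnorm A (x \<ominus> y) + cnorm A (y \<ominus> z)"
proof -
  have "x \<ominus> z = (x \<ominus> y) \<oplus> (y \<ominus> z)"
    using assms by (simp add: a_minus_def a_assoc r_neg1)
  then show ?thesis using assms by (simp add: norm_triangle)
qed

lemma norm_star [simp]: "x \<in> carrier A \<Longrightarrow> cnorm A (star A x) = cnorm A x"
proof -
  have *: "cnorm A x \<le> cnorm A (star A x)" if x: "x \<in> carrier A" for x
  proof (cases "cnorm A x = 0")
    case False
    have "cnorm A x * cnorm A x \<le> cnorm A (star A x) * cnorm A x"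
      using cstar_identity[OF x] norm_mult_le[of "star A x" x] x by (simp add: power2_eq_square)
    then show ?thesis
      using False norm_nonneg[OF x] by (simp add: mult_le_cancel_right)
  qed (simp add: norm_nonneg x)
  assume "x \<in> carrier A"
  then show ?thesis using *[of x] *[of "star A x"] by simp
qed

lemma norm_one_le: "cnorm A \<one> \<le> 1"
proof -
  have "cnorm A \<one> = (cnorm A \<one>)\<^sup>2" using cstar_identity[of \<one>] by simp
  then show ?thesis by (metis norm_nonneg one_closed order_refl power2_eq_square
        mult_cancel_right1 zero_le_one)
qed

lemma norm_isometry_le: "\<lbrakk>x \<in> carrier A; star A x \<otimes> x = \<one>\<rbrakk> \<Longrightarrow> cnorm A x \<le> 1"
  using cstar_identity[of x] norm_one_le norm_nonneg[of x] by (simp add: power_le_one_iff)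

lemma norm_eq_square: "\<lbrakk>x \<in> carrier A; star A x = x\<rbrakk> \<Longrightarrow> cnorm A (x \<otimes> x) = (cnorm A x)\<^sup>2"
  using cstar_identity[of x] by simp

lemma mult_swap:
  assumes "x \<in> carrier A" "y \<in> carrier A" "z \<in> carrier A" "x \<otimes> y = y \<otimes> x"
  shows "x \<otimes> (y \<otimes> z) = y \<otimes> (x \<otimes> z)"
  using assms by (metis m_assoc)

subsection \<open>Limits\<close>

lemma norm_tendstoI:
  assumes "\<And>m. s m \<in> carrier A" "L \<in> carrier A"
    "\<And>m. cnorm A (s m \<ominus> L) \<le> f m" "f \<longlonglongrightarrow> 0"
  shows "norm_tendsto A s L"
  unfolding norm_tendsto_def
  by (rule tendsto_sandwich[OF _ _ tendsto_const assms(4)])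
     (use assms in \<open>auto intro!: always_eventually norm_nonneg\<close>)

lemma norm_tendstoD: "norm_tendsto A s L \<Longrightarrow> (\<lambda>m. cnorm A (s m \<ominus> L)) \<longlonglongrightarrow> 0"
  by (simp add: norm_tendsto_def)

lemma norm_tendsto_const: "L \<in> carrier A \<Longrightarrow> norm_tendsto A (\<lambda>m. L) L"
  by (simp add: norm_tendsto_def a_minus_def r_neg)

lemma norm_tendsto_unique:
  assumes "\<And>m. s m \<in> carrier A" "L \<in> carrier A" "M \<in> carrier A"
    "norm_tendsto A s L" "norm_tendsto A s M"
  shows "L = M"
proof -
  have "(\<lambda>m. cnorm A (s m \<ominus> L) + cnorm A (s m \<ominus> M)) \<longlonglongrightarrow> 0 + 0"
    by (intro tendsto_add norm_tendstoD assms)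
  moreover have "cnorm A (L \<ominus> M) \<le> cnorm A (s m \<ominus> L) + cnorm A (s m \<ominus> M)" for m
    using norm_diff_triangle[of L "s m" M] assms norm_diff_commute[of L "s m"] by simp
  ultimately have "cnorm A (L \<ominus> M) \<le> 0"
    by (intro LIMSEQ_le_const[where X = "\<lambda>m. cnorm A (s m \<ominus> L) + cnorm A (s m \<ominus> M)"]) auto
  then have "L \<ominus> M = \<zero>"
    using assms norm_nonneg[of "L \<ominus> M"] norm_eq_zero_iff[of "L \<ominus> M"] by simp
  then show ?thesis using assms by simp
qed

lemma norm_tendsto_add:
  assumes "\<And>m. s m \<in> carrier A" "\<And>m. t m \<in> carrier A" "L \<in> carrier A" "M \<in> carrier A"
    "norm_tendsto A s L" "norm_tendsto A t M"
  shows "norm_tendsto A (\<lambda>m. s m \<oplus> t m) (L \<oplus> M)"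
proof (rule norm_tendstoI)
  show "(\<lambda>m. cnorm A (s m \<ominus> L) + cnorm A (t m \<ominus> M)) \<longlonglongrightarrow> 0"
    using tendsto_add[OF norm_tendstoD[OF assms(5)] norm_tendstoD[OF assms(6)]] by simp
  show "cnorm A ((s m \<oplus> t m) \<ominus> (L \<oplus> M)) \<le> cnorm A (s m \<ominus> L) + cnorm A (t m \<ominus> M)" for m
  proof -
    have "(s m \<oplus> t m) \<ominus> (L \<oplus> M) = (s m \<ominus> L) \<oplus> (t m \<ominus> M)"
      using assms by (simp add: a_minus_def minus_add a_ac)
    then show ?thesis using assms by (simp add: norm_triangle)
  qed
qed (use assms in auto)

lemma norm_tendsto_mult:
  assumes "\<And>m. s m \<in> carrier A" "\<And>m. t m \<in> carrier A" "L \<in> carrier A" "M \<in> carrier A"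
    "norm_tendsto A s L" "norm_tendsto A t M"
  shows "norm_tendsto A (\<lambda>m. s m \<otimes> t m) (L \<otimes> M)"
proof (rule norm_tendstoI)
  let ?f = "\<lambda>m. cnorm A (s m \<ominus> L) * (cnorm A (t m \<ominus> M) + cnorm A M)
             + cnorm A L * cnorm A (t m \<ominus> M)"
  have "?f \<longlonglongrightarrow> 0 * (0 + cnorm A M) + cnorm A L * 0"
    by (intro tendsto_intros norm_tendstoD assms)
  then show "?f \<longlonglongrightarrow> 0" by simp
  show "cnorm A (s m \<otimes> t m \<ominus> L \<otimes> M) \<le> ?f m" for m
  proof -
    have c: "s m \<in> carrier A" "t m \<in> carrier A" "L \<in> carrier A" "M \<in> carrier A"
      using assms by auto
    have "s m \<otimes> t m \<ominus> L \<otimes> M = (s m \<ominus> L) \<otimes> t m \<oplus> L \<otimes> (t m \<ominus> M)"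
      using c by (simp add: a_minus_def l_distr r_distr l_minus r_minus a_assoc r_neg1)
    then have "cnorm A (s m \<otimes> t m \<ominus> L \<otimes> M)
        \<le> cnorm A ((s m \<ominus> L) \<otimes> t m) + cnorm A (L \<otimes> (t m \<ominus> M))"
      using c by (simp add: norm_triangle)
    also have "\<dots> \<le> cnorm A (s m \<ominus> L) * cnorm A (t m) + cnorm A L * cnorm A (t m \<ominus> M)"
      using c by (intro add_mono norm_mult_le) auto
    also have "cnorm A (t m) \<le> cnorm A (t m \<ominus> M) + cnorm A M"
    proof -
      have "t m = (t m \<ominus> M) \<oplus> M" using c by (simp add: a_minus_def a_assoc l_neg)
      then show ?thesis using norm_triangle[of "t m \<ominus> M" M] c by simp
    qed
    finally show ?thesis using c by (simp add: mult_left_mono norm_nonneg)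
  qed
qed (use assms in auto)

lemma norm_tendsto_smult:
  assumes "\<And>m. s m \<in> carrier A" "L \<in> carrier A" "norm_tendsto A s L"
  shows "norm_tendsto A (\<lambda>m. c \<odot> s m) (c \<odot> L)"
proof (rule norm_tendstoI)
  show "(\<lambda>m. cmod c * cnorm A (s m \<ominus> L)) \<longlonglongrightarrow> 0"
    using tendsto_mult_right_zero[OF norm_tendstoD[OF assms(3)]] .
  show "cnorm A (c \<odot> s m \<ominus> c \<odot> L) \<le> cmod c * cnorm A (s m \<ominus> L)" for m
    using assms by (simp add: smult_diff[symmetric] norm_smult)
qed (use assms in auto)

lemma norm_tendsto_star:
  assumes "\<And>m. s m \<in> carrier A" "L \<in> carrier A" "norm_tendsto A s L"
  shows "norm_tendsto A (\<lambda>m. star A (s m)) (star A L)"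
  using assms by (simp add: norm_tendsto_def star_diff[symmetric] del: star_diff)

lemma norm_tendsto_shift:
  "norm_tendsto A s L \<Longrightarrow> norm_tendsto A (\<lambda>m. s (Suc m)) L"
  unfolding norm_tendsto_def by (rule LIMSEQ_Suc)

subsection \<open>Square roots\<close>

text \<open>
  The equation \<open>y\<^sup>2 = 1 - x\<close> becomes, for \<open>y = 1 - z\<close>, the fixed point equation
  \<open>z = (x + z\<^sup>2) / 2\<close>, whose right-hand side maps the ball of radius \<open>\<parallel>x\<parallel> < 1\<close> into itself and is
  a contraction there. The iterates starting at zero are polynomials in \<open>x\<close>, so that whatever
  commutes with \<open>x\<close> commutes with their limit.
\<close>

lemma sqrt_one_minus:
  assumes x: "x \<in> carrier A" "star A x = x" "cnorm A x < 1"
  shows "\<exists>y\<in>carrier A. star A y = y \<and> y \<otimes> y = \<one> \<ominus> x \<and>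
    (\<forall>z\<in>carrier A. z \<otimes> x = x \<otimes> z \<longrightarrow> z \<otimes> y = y \<otimes> z)"
proof -
  define t where "t = cnorm A x"
  have t: "0 \<le> t" "t < 1" using x norm_nonneg by (auto simp: t_def)
  \<comment> \<open>The radius \<open>t\<close> of the invariant ball is also a Lipschitz constant of \<open>\<phi>\<close> on it.\<close>
  define \<phi> where "\<phi> = (\<lambda>w. (1/2) \<odot> (x \<oplus> w \<otimes> w))"
  define z where "z = (\<lambda>m. (\<phi> ^^ m) \<zero>)"
  have z0: "z 0 = \<zero>" and zS: "\<And>m. z (Suc m) = \<phi> (z m)" by (auto simp: z_def)
  have \<phi>c [simp]: "w \<in> carrier A \<Longrightarrow> \<phi> w \<in> carrier A" for w
    using x by (simp add: \<phi>_def)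
  have zc [simp]: "z m \<in> carrier A" for m
    by (induct m) (auto simp: z0 zS)
  have zn: "cnorm A (z m) \<le> t" for m
  proof (induct m)
    case (Suc m)
    have "cnorm A (z (Suc m)) = 1/2 * cnorm A (x \<oplus> z m \<otimes> z m)"
      using x by (simp add: zS \<phi>_def norm_smult)
    also have "\<dots> \<le> 1/2 * (t + t * t)"
    proof -
      have "cnorm A (z m \<otimes> z m) \<le> cnorm A (z m) * cnorm A (z m)" by (simp add: norm_mult_le)
      also have "\<dots> \<le> t * t" using Suc by (intro mult_mono) (auto simp: norm_nonneg t)
      finally show ?thesis using norm_triangle[of x "z m \<otimes> z m"] x by (simp add: t_def)
    qed
    also have "\<dots> \<le> t" using t mult_right_mono[of t 1 t] by simp
    finally show ?case .
  qed (simp add: z0 t)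
  have contr: "cnorm A (\<phi> u \<ominus> \<phi> w) \<le> t * cnorm A (u \<ominus> w)"
    if u: "u \<in> carrier A" "cnorm A u \<le> t" and w: "w \<in> carrier A" "cnorm A w \<le> t" for u w
  proof -
    have "\<phi> u \<ominus> \<phi> w = (1/2) \<odot> ((x \<oplus> u \<otimes> u) \<ominus> (x \<oplus> w \<otimes> w))"
      using u w x by (simp add: \<phi>_def smult_diff)
    also have "(x \<oplus> u \<otimes> u) \<ominus> (x \<oplus> w \<otimes> w) = (u \<ominus> w) \<otimes> u \<oplus> w \<otimes> (u \<ominus> w)"
    proof -
      have "(x \<oplus> u \<otimes> u) \<ominus> (x \<oplus> w \<otimes> w) = u \<otimes> u \<ominus> w \<otimes> w"
        using u w x by (simp add: a_minus_def minus_add a_ac r_neg1 r_neg2)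
      also have "\<dots> = (u \<ominus> w) \<otimes> u \<oplus> w \<otimes> (u \<ominus> w)"
        using u w by (simp add: a_minus_def l_distr r_distr l_minus r_minus a_assoc r_neg1)
      finally show ?thesis .
    qed
    finally have "cnorm A (\<phi> u \<ominus> \<phi> w) = 1/2 * cnorm A ((u \<ominus> w) \<otimes> u \<oplus> w \<otimes> (u \<ominus> w))"
      using u w by (simp add: norm_smult)
    also have "\<dots> \<le> 1/2 * (cnorm A (u \<ominus> w) * cnorm A u + cnorm A w * cnorm A (u \<ominus> w))"
      using u w norm_triangle[of "(u \<ominus> w) \<otimes> u" "w \<otimes> (u \<ominus> w)"]
        norm_mult_le[of "u \<ominus> w" u] norm_mult_le[of w "u \<ominus> w"] by simp
    also have "\<dots> \<le> 1/2 * (cnorm A (u \<ominus> w) * t + t * cnorm A (u \<ominus> w))"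
      using u w by (intro mult_left_mono add_mono mult_right_mono) (auto simp: norm_nonneg)
    finally show ?thesis by simp
  qed
  have zd: "cnorm A (z (m + p) \<ominus> z m) \<le> t ^ m" for m p
  proof (induct m)
    case 0
    then show ?case using zn[of p] t by (simp add: z0 a_minus_def)
  next
    case (Suc m)
    have "cnorm A (z (Suc m + p) \<ominus> z (Suc m)) \<le> t * cnorm A (z (m + p) \<ominus> z m)"
      using contr[of "z (m+p)" "z m"] zn by (simp add: zS)
    also have "\<dots> \<le> t * t ^ m" using Suc t by (intro mult_left_mono) auto
    finally show ?case by simp
  qed
  have "norm_Cauchy A z"
    unfolding norm_Cauchy_def
  proof (intro allI impI)
    fix e :: real assume "e > 0"
    have "(\<lambda>m. t ^ m) \<longlonglongrightarrow> 0" using t by (intro LIMSEQ_power_zero) auto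
    from LIMSEQ_D[OF this \<open>e > 0\<close>] obtain N where N: "\<And>m. m \<ge> N \<Longrightarrow> t ^ m < e"
      using t by auto
    show "\<exists>N. \<forall>p\<ge>N. \<forall>q\<ge>N. cnorm A (z p \<ominus> z q) < e"
    proof (intro exI allI impI)
      fix p q assume pq: "p \<ge> N" "q \<ge> N"
      show "cnorm A (z p \<ominus> z q) < e"
      proof (cases "p \<le> q")
        case True
        then show ?thesis using zd[of p "q - p"] N[of p] pq norm_diff_commute[of "z p" "z q"] by simp
      next
        case False
        then show ?thesis using zd[of q "p - q"] N[of q] pq by simp
      qed
    qed
  qed
  with norm_complete[of z] obtain w where w: "w \<in> carrier A" "norm_tendsto A z w" by auto
  have "norm_tendsto A (\<lambda>m. \<phi> (z m)) (\<phi> w)"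
    unfolding \<phi>_def using x w
    by (intro norm_tendsto_smult norm_tendsto_add norm_tendsto_mult norm_tendsto_const) auto
  moreover have "norm_tendsto A (\<lambda>m. \<phi> (z m)) w"
    using norm_tendsto_shift[OF w(2)] by (simp add: zS)
  ultimately have fp: "\<phi> w = w"
    by (intro norm_tendsto_unique[of "\<lambda>m. \<phi> (z m)"]) (auto simp: w)
  have zsa: "star A (z m) = z m" for m
    by (induct m) (use x in \<open>auto simp: z0 zS \<phi>_def\<close>)
  have wsa: "star A w = w"
    by (rule norm_tendsto_unique[of z])
       (use norm_tendsto_star[of z w] zsa w in auto)
  have zcomm: "u \<otimes> z m = z m \<otimes> u" if "u \<in> carrier A" "u \<otimes> x = x \<otimes> u" for u m
  proof (induct m)
    case (Suc m)
    have "u \<otimes> (z m \<otimes> z m) = z m \<otimes> z m \<otimes> u"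
      using that by (metis Suc m_assoc zc)
    then show ?case using that x by (simp add: zS \<phi>_def r_distr l_distr)
  qed (use that in \<open>simp add: z0\<close>)
  have wcomm: "u \<otimes> w = w \<otimes> u" if u: "u \<in> carrier A" "u \<otimes> x = x \<otimes> u" for u
  proof (rule norm_tendsto_unique[of "\<lambda>m. u \<otimes> z m"])
    show "norm_tendsto A (\<lambda>m. u \<otimes> z m) (w \<otimes> u)"
      unfolding zcomm[OF u] using u w by (intro norm_tendsto_mult norm_tendsto_const) auto
    show "norm_tendsto A (\<lambda>m. u \<otimes> z m) (u \<otimes> w)"
      using u w by (intro norm_tendsto_mult norm_tendsto_const) auto
  qed (use u w in auto)
  show ?thesis
  proof (intro bexI[of _ "\<one> \<ominus> w"] conjI ballI impI)
    have "(2::complex) \<odot> w = x \<oplus> w \<otimes> w"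
    proof -
      have "(2::complex) \<odot> \<phi> w = x \<oplus> w \<otimes> w" using x w by (simp add: \<phi>_def)
      then show ?thesis by (simp only: fp)
    qed
    then have ww: "w \<otimes> w = (2::complex) \<odot> w \<ominus> x"
      using x w by (simp add: a_minus_def a_ac r_neg1 r_neg2)
    have "(\<one> \<ominus> w) \<otimes> (\<one> \<ominus> w) = \<one> \<oplus> (- 2) \<odot> w \<oplus> w \<otimes> w"
      using w add_smult[of w "-1" "-1"]
      by (simp add: diff_eq_smult l_distr r_distr a_assoc smult_add)
    also have "\<dots> = \<one> \<oplus> ((-2) \<odot> w \<oplus> 2 \<odot> w) \<ominus> x"
      unfolding ww using w x by (simp add: a_minus_def a_assoc)
    also have "(-2) \<odot> w \<oplus> 2 \<odot> w = \<zero>"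
      using w by (simp flip: add_smult)
    finally show "(\<one> \<ominus> w) \<otimes> (\<one> \<ominus> w) = \<one> \<ominus> x" using x by simp
    show "u \<otimes> (\<one> \<ominus> w) = (\<one> \<ominus> w) \<otimes> u" if "u \<in> carrier A" "u \<otimes> x = x \<otimes> u" for u
      using that wcomm[OF that] w by (simp add: diff_eq_smult l_distr r_distr)
  qed (use w wsa in auto)
qed


subsection \<open>Norm estimates without positivity\<close>

text \<open>
  The element \<open>u = e + i g\<close> satisfies \<open>u\<^sup>* u = \<epsilon>\<close>, hence \<open>\<parallel>u\<parallel>\<^sup>2 \<le> \<epsilon>\<close> by the C*-identity, and \<open>e\<close> is
  its real part. Together with square roots, this takes the place of spectral theory below.
\<close>

lemma norm_le_of_sum_of_squares:
  assumes e: "e \<in> carrier A" "star A e = e" and g: "g \<in> carrier A" "star A g = g"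
    and comm: "e \<otimes> g = g \<otimes> e" and eq: "e \<otimes> e \<oplus> g \<otimes> g = complex_of_real \<epsilon> \<odot> \<one>" and "0 \<le> \<epsilon>"
  shows "(cnorm A e)\<^sup>2 \<le> \<epsilon>"
proof -
  define u where "u = e \<oplus> \<i> \<odot> g"
  have uc: "u \<in> carrier A" using e g by (simp add: u_def)
  have su: "star A u = e \<oplus> (- \<i>) \<odot> g" using e g by (simp add: u_def)
  have "star A u \<otimes> u = e \<otimes> e \<oplus> (\<i> \<odot> (g \<otimes> e) \<oplus> (- \<i>) \<odot> (g \<otimes> e)) \<oplus> g \<otimes> g"
    unfolding su u_def using e g by (simp add: l_distr r_distr a_ac comm smult_add)
  also have "\<i> \<odot> (g \<otimes> e) \<oplus> (- \<i>) \<odot> (g \<otimes> e) = \<zero>"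
    using e g by (simp flip: add_smult)
  finally have "star A u \<otimes> u = complex_of_real \<epsilon> \<odot> \<one>"
    using e g eq by simp
  then have "(cnorm A u)\<^sup>2 = \<epsilon> * cnorm A \<one>"
    using cstar_identity[OF uc] \<open>0 \<le> \<epsilon>\<close> by (simp add: norm_smult)
  also have "\<dots> \<le> \<epsilon>" using norm_one_le \<open>0 \<le> \<epsilon>\<close> by (rule mult_left_le)
  finally have u2: "(cnorm A u)\<^sup>2 \<le> \<epsilon>" .
  have "(2::complex) \<odot> e = u \<oplus> star A u"
  proof -
    have "u \<oplus> star A u = (e \<oplus> e) \<oplus> (\<i> \<odot> g \<oplus> (- \<i>) \<odot> g)"
      unfolding su u_def using e g by (simp add: a_ac)
    also have "\<i> \<odot> g \<oplus> (- \<i>) \<odot> g = \<zero>" using g by (simp flip: add_smult)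
    also have "e \<oplus> e = (2::complex) \<odot> e" using e add_smult[of e 1 1] by simp
    finally show ?thesis using e by simp
  qed
  then have "2 * cnorm A e \<le> cnorm A u + cnorm A (star A u)"
    using norm_triangle[of u "star A u"] uc e norm_smult[of e 2] by simp
  then have "cnorm A e \<le> cnorm A u" using uc by simp
  then have "(cnorm A e)\<^sup>2 \<le> (cnorm A u)\<^sup>2" using e by (intro power_mono norm_nonneg) auto
  with u2 show ?thesis by simp
qed

text \<open>
  Put \<open>b = a\<^sup>2\<close>, \<open>f = \<surd>(1 + b/2)\<close> and \<open>p = a f\<close>. For \<open>0 < r < 1\<close> there are commuting self-adjoint
  elements \<open>e\<close> and \<open>g = \<surd>2 r p\<close> with \<open>e\<^sup>2 = 1 - r\<^sup>2(1 + b)\<^sup>2\<close> and \<open>g\<^sup>2 = r\<^sup>2(2b + b\<^sup>2)\<close>. Their squares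
  add up to \<open>1 - r\<^sup>2\<close>, whence \<open>\<parallel>g\<parallel>\<^sup>2 \<le> 1 - r\<^sup>2\<close>, and \<open>r \<rightarrow> 1\<close> gives \<open>p = 0\<close>. Then
  \<open>0 = p f = a + a b/2\<close>, which is impossible for \<open>0 < \<parallel>a\<parallel> \<le> 1\<close>.
\<close>

lemma selfadjoint_eq_zero_of_norm_one_plus_square:
  assumes a: "a \<in> carrier A" "star A a = a" and a1: "cnorm A a \<le> 1"
    and le: "cnorm A (\<one> \<oplus> a \<otimes> a) \<le> 1"
  shows "a = \<zero>"
proof -
  define b where "b = a \<otimes> a"
  have b: "b \<in> carrier A" "star A b = b" using a by (auto simp: b_def)
  have b1: "cnorm A b \<le> 1" using a a1 norm_eq_square[of a] norm_nonneg[of a]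
    by (simp add: b_def power_le_one_iff)
  obtain f where f: "f \<in> carrier A" "star A f = f" "f \<otimes> f = \<one> \<ominus> (- 1/2) \<odot> b"
    and fcomm: "\<And>z. \<lbrakk>z \<in> carrier A; z \<otimes> ((- 1/2) \<odot> b) = ((- 1/2) \<odot> b) \<otimes> z\<rbrakk> \<Longrightarrow> z \<otimes> f = f \<otimes> z"
  proof -
    have "cnorm A ((- 1/2) \<odot> b) < 1" "(- 1/2) \<odot> b \<in> carrier A"
      "star A ((- 1/2) \<odot> b) = (- 1/2) \<odot> b"
      using b b1 by (simp_all add: norm_smult)
    then show thesis using sqrt_one_minus[of "(- 1/2) \<odot> b"] that by blast
  qed
  have ff: "f \<otimes> f = \<one> \<oplus> (1/2) \<odot> b" using f b by (simp add: diff_eq_smult)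
  have af: "a \<otimes> f = f \<otimes> a" using a by (intro fcomm) (simp_all add: b_def m_assoc)
  define p where "p = a \<otimes> f"
  have p: "p \<in> carrier A" "star A p = p" using a f af by (auto simp: p_def)
  have pp: "p \<otimes> p = b \<oplus> (1/2) \<odot> (b \<otimes> b)"
  proof -
    have "p \<otimes> p = a \<otimes> a \<otimes> (f \<otimes> f)"
      using a b f by (simp add: p_def m_assoc mult_swap[OF f(1) a(1) f(1) af[symmetric]])
    then show ?thesis using a b by (simp add: ff r_distr flip: b_def)
  qed
  have "z * (2 * (cnorm A p)\<^sup>2 + 1) \<le> 1" if z: "0 < z" "z < 1" for z :: real
  proof -
    define r where "r = sqrt z"
    have r: "0 < r" "r < 1" "r * r = z" using z by (auto simp: r_def)
    define s where "s = complex_of_real r \<odot> (\<one> \<oplus> b)"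
    have s: "s \<in> carrier A" "star A s = s" using b by (auto simp: s_def)
    have "cnorm A s \<le> r * 1"
      using le b r by (simp add: s_def norm_smult flip: b_def)
    then have "cnorm A s < 1" using r by simp
    then have "cnorm A (s \<otimes> s) < 1"
      using s norm_eq_square[of s] norm_nonneg[of s] by (simp add: power_less_one_iff)
    then obtain e where e: "e \<in> carrier A" "star A e = e" "e \<otimes> e = \<one> \<ominus> s \<otimes> s"
      and ecomm: "\<And>z. \<lbrakk>z \<in> carrier A; z \<otimes> (s \<otimes> s) = s \<otimes> s \<otimes> z\<rbrakk> \<Longrightarrow> z \<otimes> e = e \<otimes> z"
      using sqrt_one_minus[of "s \<otimes> s"] s by (metis m_closed star_mult)
    define g where "g = complex_of_real (sqrt 2 * r) \<odot> p"
    have g: "g \<in> carrier A" "star A g = g" using p by (auto simp: g_def)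
    have fb: "f \<otimes> b = b \<otimes> f"
      using a f af by (simp add: b_def) (metis m_assoc)
    have pb: "p \<otimes> b = b \<otimes> p"
      using a f b fb unfolding p_def b_def by (metis m_assoc m_closed)
    have "p \<otimes> s = s \<otimes> p"
      using p b pb by (simp add: s_def l_distr r_distr)
    then have "p \<otimes> e = e \<otimes> p"
      using p s by (intro ecomm) (metis m_assoc)+
    then have ge: "e \<otimes> g = g \<otimes> e" using e p by (simp add: g_def)
    have ss: "s \<otimes> s = complex_of_real z \<odot> (\<one> \<oplus> 2 \<odot> b \<oplus> b \<otimes> b)"
    proof -
      have "s \<otimes> s = complex_of_real (r * r) \<odot> ((\<one> \<oplus> b) \<otimes> (\<one> \<oplus> b))"
        using b by (simp add: s_def)
      also have "(\<one> \<oplus> b) \<otimes> (\<one> \<oplus> b) = \<one> \<oplus> 2 \<odot> b \<oplus> b \<otimes> b"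
        using b add_smult[of b 1 1] by (simp add: l_distr r_distr a_assoc)
      finally show ?thesis by (simp only: r)
    qed
    have gg: "g \<otimes> g = complex_of_real z \<odot> (2 \<odot> b \<oplus> b \<otimes> b)"
    proof -
      have "g \<otimes> g = complex_of_real ((sqrt 2 * r) * (sqrt 2 * r)) \<odot> (p \<otimes> p)"
        using p by (simp add: g_def)
      also have "(sqrt 2 * r) * (sqrt 2 * r) = z * 2"
      proof -
        have "(sqrt 2 * r) * (sqrt 2 * r) = (sqrt 2 * sqrt 2) * (r * r)" by (simp only: mult_ac)
        then show ?thesis by (simp add: r(3))
      qed
      finally show ?thesis using b by (simp add: pp smult_add)
    qed
    have "e \<otimes> e \<oplus> g \<otimes> g = complex_of_real (1 - z) \<odot> \<one>"
    proof -
      define y where "y = 2 \<odot> b \<oplus> b \<otimes> b"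
      have y: "y \<in> carrier A" using b by (simp add: y_def)
      have "e \<otimes> e \<oplus> g \<otimes> g
          = \<one> \<oplus> (- complex_of_real z) \<odot> \<one> \<oplus> ((- complex_of_real z) \<odot> y \<oplus> complex_of_real z \<odot> y)"
        unfolding e ss gg using b y
        by (simp add: a_assoc diff_eq_smult smult_add flip: y_def)
      also have "(- complex_of_real z) \<odot> y \<oplus> complex_of_real z \<odot> y = \<zero>"
        using y by (simp flip: add_smult)
      also have "\<one> \<oplus> (- complex_of_real z) \<odot> \<one> = complex_of_real (1 - z) \<odot> \<one>"
        using add_smult[of \<one> 1 "- complex_of_real z"] by simp
      finally show ?thesis by simp
    qed
    moreover have "e \<otimes> e \<oplus> g \<otimes> g = g \<otimes> g \<oplus> e \<otimes> e" using e(1) g(1) by (simp add: a_comm)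
    ultimately have "(cnorm A g)\<^sup>2 \<le> 1 - z"
      using e(1,2) g ge z by (intro norm_le_of_sum_of_squares[of g e]) auto
    moreover have "(cnorm A g)\<^sup>2 = 2 * z * (cnorm A p)\<^sup>2"
    proof -
      have "cnorm A g = \<bar>sqrt 2 * r\<bar> * cnorm A p"
        using p by (simp only: g_def norm_smult norm_of_real)
      then show ?thesis
        by (simp add: power_mult_distrib r(3) flip: power2_eq_square) (simp add: power2_eq_square r(3))
    qed
    ultimately show ?thesis by (simp add: algebra_simps)
  qed
  then have "2 * (cnorm A p)\<^sup>2 + 1 \<le> 1" by (rule field_le_mult_one_interval)
  then have "p = \<zero>" using p by (simp add: norm_eq_zero_iff)
  then have "p \<otimes> f = \<zero>" using f by simp
  then have "a \<oplus> (1/2) \<odot> (a \<otimes> b) = \<zero>"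
    using a f(1) b ff by (simp add: p_def m_assoc r_distr)
  then have "\<ominus> ((1/2) \<odot> (a \<otimes> b)) = a"
    using a b by (intro minus_equality) auto
  then have "a = (- 1/2) \<odot> (a \<otimes> b)"
    using a b by (simp add: minus_eq_smult)
  then have "cnorm A a = cmod (- 1/2) * cnorm A (a \<otimes> b)"
    using a b by (metis norm_smult m_closed)
  then have "cnorm A a = 1/2 * cnorm A (a \<otimes> b)" by simp
  also have "\<dots> \<le> 1/2 * (cnorm A a * 1)"
    using norm_mult_le[of a b] a b b1 mult_left_mono[OF b1 norm_nonneg[of a]] by simp
  finally show ?thesis using a norm_nonneg[of a] norm_eq_zero_iff[of a] by simp
qed

text \<open>
  Among self-adjoint elements, the unit is an extreme point of the unit ball. As
  \<open>1 + b\<^sup>2\<close> is the mean of \<open>(1 + b)\<^sup>2\<close> and \<open>(1 - b)\<^sup>2\<close>, it has norm at most one as well. The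
  result serves as a substitute for the antisymmetry of the order of a C*-algebra.
\<close>

lemma selfadjoint_eq_zero_of_norm_one_pm:
  assumes b: "b \<in> carrier A" "star A b = b"
    and plus: "cnorm A (\<one> \<oplus> b) \<le> 1" and minus: "cnorm A (\<one> \<ominus> b) \<le> 1"
  shows "b = \<zero>"
proof (rule selfadjoint_eq_zero_of_norm_one_plus_square)
  have two: "x \<oplus> x = 2 \<odot> x" if "x \<in> carrier A" for x
    using that add_smult[of x 1 1] by simp
  have "(\<one> \<oplus> b) \<ominus> (\<one> \<ominus> b) = 2 \<odot> b"
    using b by (simp add: a_minus_def minus_add a_ac r_neg1 r_neg two)
  then have "2 * cnorm A b \<le> 1 + 1"
    using norm_diff_le[of "\<one> \<oplus> b" "\<one> \<ominus> b"] plus minus b norm_smult[of b 2] by simp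
  then show "cnorm A b \<le> 1" by simp
  have "(\<one> \<oplus> b) \<otimes> (\<one> \<oplus> b) \<oplus> (\<one> \<ominus> b) \<otimes> (\<one> \<ominus> b) = 2 \<odot> (\<one> \<oplus> b \<otimes> b)"
  proof -
    define u where "u = \<one> \<oplus> b \<otimes> b"
    have u: "u \<in> carrier A" using b by (simp add: u_def)
    have "(\<one> \<oplus> b) \<otimes> (\<one> \<oplus> b) = u \<oplus> 2 \<odot> b"
      using b by (simp add: u_def l_distr r_distr a_ac flip: two)
    moreover have "(\<one> \<ominus> b) \<otimes> (\<one> \<ominus> b) = u \<oplus> (-2) \<odot> b"
      using b add_smult[of b "-1" "-1"]
      by (simp add: u_def diff_eq_smult l_distr r_distr a_ac smult_add)
    moreover have "(u \<oplus> 2 \<odot> b) \<oplus> (u \<oplus> (-2) \<odot> b) = (u \<oplus> u) \<oplus> (2 \<odot> b \<oplus> (-2) \<odot> b)"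
      using u b by (simp add: a_ac)
    moreover have "2 \<odot> b \<oplus> (-2) \<odot> b = \<zero>" using b by (simp flip: add_smult)
    ultimately show ?thesis using u by (simp add: two flip: u_def)
  qed
  then have "2 * cnorm A (\<one> \<oplus> b \<otimes> b)
      \<le> cnorm A ((\<one> \<oplus> b) \<otimes> (\<one> \<oplus> b)) + cnorm A ((\<one> \<ominus> b) \<otimes> (\<one> \<ominus> b))"
    using norm_triangle[of "(\<one> \<oplus> b) \<otimes> (\<one> \<oplus> b)" "(\<one> \<ominus> b) \<otimes> (\<one> \<ominus> b)"] b
      norm_smult[of "\<one> \<oplus> b \<otimes> b" 2] by simp
  also have "\<dots> \<le> 1 + 1"
    using plus minus b by (intro add_mono)
      (auto simp: norm_eq_square power_le_one_iff norm_nonneg)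
  finally show "cnorm A (\<one> \<oplus> b \<otimes> b) \<le> 1" by simp
qed (use b in auto)

end

subsection \<open>Homomorphisms are contractive\<close>

lemma star_homD:
  assumes "h \<in> star_hom A B"
  shows "x \<in> carrier A \<Longrightarrow> h x \<in> carrier B"
    and "\<lbrakk>x \<in> carrier A; y \<in> carrier A\<rbrakk> \<Longrightarrow> h (x \<otimes>\<^bsub>A\<^esub> y) = h x \<otimes>\<^bsub>B\<^esub> h y"
    and "\<lbrakk>x \<in> carrier A; y \<in> carrier A\<rbrakk> \<Longrightarrow> h (x \<oplus>\<^bsub>A\<^esub> y) = h x \<oplus>\<^bsub>B\<^esub> h y"
    and "h \<one>\<^bsub>A\<^esub> = \<one>\<^bsub>B\<^esub>"
    and "x \<in> carrier A \<Longrightarrow> h (star A x) = star B (h x)"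
    and "x \<in> carrier A \<Longrightarrow> h (c \<odot>\<^bsub>A\<^esub> x) = c \<odot>\<^bsub>B\<^esub> h x"
  using assms by (auto simp: star_hom_def ring_hom_def)

lemma star_hom_zero:
  assumes "unital_cstar_algebra A" "unital_cstar_algebra B" "h \<in> star_hom A B"
  shows "h \<zero>\<^bsub>A\<^esub> = \<zero>\<^bsub>B\<^esub>"
proof -
  interpret A: unital_cstar_algebra A by fact
  interpret B: unital_cstar_algebra B by fact
  show ?thesis
    using star_homD(6)[OF assms(3), of "\<zero>\<^bsub>A\<^esub>" 0] star_homD(1)[OF assms(3), of "\<zero>\<^bsub>A\<^esub>"] by simp
qed

lemma star_hom_diff:
  assumes "unital_cstar_algebra A" "unital_cstar_algebra B" "h \<in> star_hom A B"
    "x \<in> carrier A" "y \<in> carrier A"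
  shows "h (x \<ominus>\<^bsub>A\<^esub> y) = h x \<ominus>\<^bsub>B\<^esub> h y"
proof -
  interpret A: unital_cstar_algebra A by fact
  interpret B: unital_cstar_algebra B by fact
  show ?thesis
    using assms(4,5) star_homD[OF assms(3)] by (simp add: A.diff_eq_smult B.diff_eq_smult)
qed

text \<open>
  If \<open>\<parallel>x\<parallel> < 1\<close>, the element \<open>a = x\<^sup>* x\<close> is the real part of the unitary \<open>a + i \<surd>(1 - a\<^sup>2)\<close>; hence
  so is its image, and \<open>\<parallel>h x\<parallel>\<^sup>2 = \<parallel>h a\<parallel> \<le> 1\<close>.
\<close>

lemma star_hom_contractive:
  assumes A: "unital_cstar_algebra A" and B: "unital_cstar_algebra B" and h: "h \<in> star_hom A B"
    and x: "x \<in> carrier A"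
  shows "cnorm B (h x) \<le> cnorm A x"
proof -
  interpret A: unital_cstar_algebra A by fact
  interpret B: unital_cstar_algebra B by fact
  note hD [simp] = star_homD[OF h]
  have unit_ball: "cnorm B (h y) \<le> 1" if y: "y \<in> carrier A" "cnorm A y < 1" for y
  proof -
    define a where "a = star A y \<otimes>\<^bsub>A\<^esub> y"
    have a: "a \<in> carrier A" "star A a = a" using y by (auto simp: a_def)
    have "cnorm A a = (cnorm A y)\<^sup>2" using y by (simp add: a_def A.cstar_identity)
    then have "cnorm A a < 1" using y A.norm_nonneg[of y] by (simp add: power_less_one_iff)
    then have "cnorm A (a \<otimes>\<^bsub>A\<^esub> a) < 1"
      using a A.norm_nonneg[of a] by (simp add: A.norm_eq_square power_less_one_iff)
    then obtain g where g: "g \<in> carrier A" "star A g = g" "g \<otimes>\<^bsub>A\<^esub> g = \<one>\<^bsub>A\<^esub> \<ominus>\<^bsub>A\<^esub> a \<otimes>\<^bsub>A\<^esub> a"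
      and gcomm: "\<And>z. \<lbrakk>z \<in> carrier A; z \<otimes>\<^bsub>A\<^esub> (a \<otimes>\<^bsub>A\<^esub> a) = a \<otimes>\<^bsub>A\<^esub> a \<otimes>\<^bsub>A\<^esub> z\<rbrakk> \<Longrightarrow> z \<otimes>\<^bsub>A\<^esub> g = g \<otimes>\<^bsub>A\<^esub> z"
      using A.sqrt_one_minus[of "a \<otimes>\<^bsub>A\<^esub> a"] a by (metis A.m_closed A.star_mult)
    have ag: "a \<otimes>\<^bsub>A\<^esub> g = g \<otimes>\<^bsub>A\<^esub> a" using a by (intro gcomm) (simp_all add: A.m_assoc)
    have sum: "a \<otimes>\<^bsub>A\<^esub> a \<oplus>\<^bsub>A\<^esub> g \<otimes>\<^bsub>A\<^esub> g = \<one>\<^bsub>A\<^esub>"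
      unfolding g using a by (simp add: a_minus_def A.a_ac A.r_neg1 A.r_neg2 A.r_neg)
    have "(cnorm B (h a))\<^sup>2 \<le> 1"
    proof (rule B.norm_le_of_sum_of_squares[where g = "h g"])
      show "star B (h a) = h a" "star B (h g) = h g"
        using a g by (simp_all flip: hD(5))
      show "h a \<otimes>\<^bsub>B\<^esub> h g = h g \<otimes>\<^bsub>B\<^esub> h a" using a g ag by (simp flip: hD(2))
      show "h a \<otimes>\<^bsub>B\<^esub> h a \<oplus>\<^bsub>B\<^esub> h g \<otimes>\<^bsub>B\<^esub> h g = complex_of_real 1 \<odot>\<^bsub>B\<^esub> \<one>\<^bsub>B\<^esub>"
        using a g sum hD(4) by (simp flip: hD(2) hD(3))
    qed (use a g in auto)
    moreover have "h a = star B (h y) \<otimes>\<^bsub>B\<^esub> h y" using y by (simp add: a_def)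
    ultimately show ?thesis
      using y B.norm_nonneg[of "h y"] by (simp add: B.cstar_identity power_le_one_iff)
  qed
  show ?thesis
  proof (rule dense_ge)
    fix r assume r: "cnorm A x < r"
    then have "0 < r" using A.norm_nonneg[OF x] by simp
    have "cnorm B (h (complex_of_real (1/r) \<odot>\<^bsub>A\<^esub> x)) \<le> 1"
      using r \<open>0 < r\<close> x by (intro unit_ball) (auto simp: A.norm_smult norm_divide)
    then show "cnorm B (h x) \<le> r"
      using \<open>0 < r\<close> x by (simp add: B.norm_smult norm_divide field_simps)
  qed
qed

lemma star_hom_norm_tendsto:
  assumes A: "unital_cstar_algebra A" and B: "unital_cstar_algebra B" and h: "h \<in> star_hom A B"
    and s: "\<And>m. s m \<in> carrier A" "L \<in> carrier A" "norm_tendsto A s L"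
  shows "norm_tendsto B (\<lambda>m. h (s m)) (h L)"
proof -
  interpret A: unital_cstar_algebra A by fact
  interpret B: unital_cstar_algebra B by fact
  show ?thesis
  proof (rule B.norm_tendstoI)
    show "cnorm B (h (s m) \<ominus>\<^bsub>B\<^esub> h L) \<le> cnorm A (s m \<ominus>\<^bsub>A\<^esub> L)" for m
      using s star_hom_contractive[OF A B h, of "s m \<ominus>\<^bsub>A\<^esub> L"] star_hom_diff[OF A B h, of "s m" L]
      by simp
  qed (use s star_homD(1)[OF h] A.norm_tendstoD in auto)
qed

section \<open>Finite sums and C*-subalgebras\<close>

context unital_cstar_algebra
begin

lemma smult_finsum:
  "(\<And>i. i \<in> I \<Longrightarrow> f i \<in> carrier A) \<Longrightarrow> c \<odot> (\<Oplus>i\<in>I. f i) = (\<Oplus>i\<in>I. c \<odot> f i)"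
  by (induct I rule: infinite_finite_induct) (auto simp: Pi_def smult_add)

lemma star_finsum:
  "(\<And>i. i \<in> I \<Longrightarrow> f i \<in> carrier A) \<Longrightarrow> star A (\<Oplus>i\<in>I. f i) = (\<Oplus>i\<in>I. star A (f i))"
  by (induct I rule: infinite_finite_induct) (auto simp: Pi_def)

lemma mult_finsum:
  "\<lbrakk>x \<in> carrier A; \<And>i. i \<in> I \<Longrightarrow> f i \<in> carrier A\<rbrakk> \<Longrightarrow> x \<otimes> (\<Oplus>i\<in>I. f i) = (\<Oplus>i\<in>I. x \<otimes> f i)"
  by (induct I rule: infinite_finite_induct) (auto simp: Pi_def r_distr)

lemma finsum_mult:
  "\<lbrakk>x \<in> carrier A; \<And>i. i \<in> I \<Longrightarrow> f i \<in> carrier A\<rbrakk> \<Longrightarrow> (\<Oplus>i\<in>I. f i) \<otimes> x = (\<Oplus>i\<in>I. f i \<otimes> x)"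
  by (induct I rule: infinite_finite_induct) (auto simp: Pi_def l_distr)

lemma finsum_smult_const:
  "x \<in> carrier A \<Longrightarrow> (\<Oplus>i\<in>I. c i \<odot> x) = (\<Sum>i\<in>I. c i) \<odot> x"
  by (induct I rule: infinite_finite_induct) (auto simp: Pi_def add_smult)

lemma finsum_delta:
  assumes "finite I" "j \<in> I" "\<And>i. i \<in> I \<Longrightarrow> x i \<in> carrier A"
  shows "(\<Oplus>i\<in>I. of_bool (i = j) \<odot> x i) = x j"
proof -
  have "(\<Oplus>i\<in>I. of_bool (i = j) \<odot> x i) = (\<Oplus>i\<in>I. if j = i then x i else \<zero>)"
    using assms by (intro finsum_cong') auto
  also have "\<dots> = x j" using assms by (intro finsum_singleton) auto
  finally show ?thesis .
qed

lemma finsum_swap: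
  assumes "finite I" "finite J" "\<And>i j. \<lbrakk>i \<in> I; j \<in> J\<rbrakk> \<Longrightarrow> f i j \<in> carrier A"
  shows "(\<Oplus>i\<in>I. \<Oplus>j\<in>J. f i j) = (\<Oplus>j\<in>J. \<Oplus>i\<in>I. f i j)"
  using assms(1,3)
proof (induct I)
  case (insert a I)
  have "(\<Oplus>i\<in>insert a I. \<Oplus>j\<in>J. f i j) = (\<Oplus>j\<in>J. f a j) \<oplus> (\<Oplus>j\<in>J. \<Oplus>i\<in>I. f i j)"
    using insert by (simp add: Pi_def)
  also have "\<dots> = (\<Oplus>j\<in>J. f a j \<oplus> (\<Oplus>i\<in>I. f i j))"
    using insert by (intro finsum_addf[symmetric]) auto
  also have "\<dots> = (\<Oplus>j\<in>J. \<Oplus>i\<in>insert a I. f i j)"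
    using insert by (intro finsum_cong') (auto simp: Pi_def)
  finally show ?case .
qed simp

lemma norm_finsum_le:
  "(\<And>i. i \<in> I \<Longrightarrow> f i \<in> carrier A) \<Longrightarrow> cnorm A (\<Oplus>i\<in>I. f i) \<le> (\<Sum>i\<in>I. cnorm A (f i))"
proof (induct I rule: infinite_finite_induct)
  case (insert a I)
  then show ?case using norm_triangle[of "f a" "\<Oplus>i\<in>I. f i"] by (simp add: Pi_def)
qed auto

lemma star_nat_pow: "x \<in> carrier A \<Longrightarrow> star A (x [^] (l::nat)) = star A x [^] l"
proof (induct l)
  case (Suc l)
  then have "star A (x [^] Suc l) = star A x \<otimes> star A x [^] l" by simp
  then show ?case using nat_pow_Suc2[of "star A x" l] Suc by simp
qed simp

lemma smult_nat_pow: "x \<in> carrier A \<Longrightarrow> (c \<odot> x) [^] (l::nat) = (c ^ l) \<odot> (x [^] l)"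
  by (induct l) (auto simp: mult.commute)

lemma norm_tendsto_finsum:
  assumes "\<And>i m. i \<in> I \<Longrightarrow> f i m \<in> carrier A" "\<And>i. i \<in> I \<Longrightarrow> L i \<in> carrier A"
    "\<And>i. i \<in> I \<Longrightarrow> norm_tendsto A (f i) (L i)"
  shows "norm_tendsto A (\<lambda>m. \<Oplus>i\<in>I. f i m) (\<Oplus>i\<in>I. L i)"
  using assms
proof (induct I rule: infinite_finite_induct)
  case (insert a I)
  have "norm_tendsto A (\<lambda>m. f a m \<oplus> (\<Oplus>i\<in>I. f i m)) (L a \<oplus> (\<Oplus>i\<in>I. L i))"
    using insert by (intro norm_tendsto_add) (auto simp: Pi_def)
  then show ?case using insert by (simp add: Pi_def)
qed (simp_all add: norm_tendsto_const)

lemma norm_tendsto_imp_Cauchy: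
  assumes "\<And>m. s m \<in> carrier A" "L \<in> carrier A" "norm_tendsto A s L"
  shows "norm_Cauchy A s"
  unfolding norm_Cauchy_def
proof (intro allI impI)
  fix e :: real assume "e > 0"
  then obtain N where N: "\<And>m. m \<ge> N \<Longrightarrow> cnorm A (s m \<ominus> L) < e/2"
    using LIMSEQ_D[OF norm_tendstoD[OF assms(3)], of "e/2"] assms norm_nonneg by fastforce
  have "cnorm A (s p \<ominus> s q) < e" if "p \<ge> N" "q \<ge> N" for p q
    using N[OF that(1)] N[OF that(2)] norm_diff_triangle[of "s p" L "s q"]
      norm_diff_commute[of L "s q"] assms by simp
  then show "\<exists>N. \<forall>p\<ge>N. \<forall>q\<ge>N. cnorm A (s p \<ominus> s q) < e" by blast
qed

lemma cstar_subalgebra_carrier: "cstar_subalgebra A (carrier A)"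
  by (auto simp: cstar_subalgebra_def)

end

lemma cstar_subalgebraD:
  assumes "cstar_subalgebra A B"
  shows "x \<in> B \<Longrightarrow> x \<in> carrier A" and "\<zero>\<^bsub>A\<^esub> \<in> B"
    and "\<lbrakk>x \<in> B; y \<in> B\<rbrakk> \<Longrightarrow> x \<oplus>\<^bsub>A\<^esub> y \<in> B" and "\<lbrakk>x \<in> B; y \<in> B\<rbrakk> \<Longrightarrow> x \<otimes>\<^bsub>A\<^esub> y \<in> B"
    and "x \<in> B \<Longrightarrow> star A x \<in> B" and "x \<in> B \<Longrightarrow> c \<odot>\<^bsub>A\<^esub> x \<in> B"
    and "\<lbrakk>\<And>m. s m \<in> B; L \<in> carrier A; norm_tendsto A s L\<rbrakk> \<Longrightarrow> L \<in> B"
  using assms unfolding cstar_subalgebra_def by blast+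

lemma cstar_generated_least:
  "\<lbrakk>cstar_subalgebra A B; G \<subseteq> B\<rbrakk> \<Longrightarrow> cstar_generated A G \<subseteq> B"
  by (auto simp: cstar_generated_def)

lemma cstar_generated_superset: "G \<subseteq> cstar_generated A G"
  by (auto simp: cstar_generated_def)

lemma (in unital_cstar_algebra) cstar_subalgebra_generated:
  assumes "G \<subseteq> carrier A"
  shows "cstar_subalgebra A (cstar_generated A G)"
proof -
  have sub: "cstar_generated A G \<subseteq> carrier A"
    by (intro cstar_generated_least cstar_subalgebra_carrier assms)
  have lim: "L \<in> cstar_generated A G"
    if s: "\<And>m. s m \<in> cstar_generated A G" and L: "L \<in> carrier A" "norm_tendsto A s L" for s L
    unfolding cstar_generated_def
  proof (rule InterI, clarify)
    fix B assume B: "cstar_subalgebra A B" "G \<subseteq> B"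
    then have "s m \<in> B" for m using s cstar_generated_least by blast
    then show "L \<in> B" using L by (rule cstar_subalgebraD(7)[OF B(1)])
  qed
  have zero: "\<zero> \<in> cstar_generated A G"
    by (simp add: cstar_generated_def cstar_subalgebraD(2))
  have closed: "x \<oplus> y \<in> cstar_generated A G" "x \<otimes> y \<in> cstar_generated A G"
    "star A x \<in> cstar_generated A G" "c \<odot> x \<in> cstar_generated A G"
    if "x \<in> cstar_generated A G" "y \<in> cstar_generated A G" for x y c
    using that unfolding cstar_generated_def by (blast intro: cstar_subalgebraD(3-6))+
  show ?thesis
    unfolding cstar_subalgebra_def[of A "cstar_generated A G"]
  proof (intro conjI ballI allI impI)
    fix s L assume "(\<forall>m. s m \<in> cstar_generated A G) \<and> L \<in> carrier A \<and> norm_tendsto A s L"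
    then show "L \<in> cstar_generated A G" using lim[of s L] by blast
  qed (fact sub zero | (rule closed; assumption))+
qed

lemma (in unital_cstar_algebra) cstar_subalgebra_finsum:
  assumes "cstar_subalgebra A B" "\<And>i. i \<in> I \<Longrightarrow> f i \<in> B"
  shows "(\<Oplus>i\<in>I. f i) \<in> B"
  using assms(2)
proof (induct I rule: infinite_finite_induct)
  case (insert a I)
  then show ?case
    using cstar_subalgebraD(1,3)[OF assms(1)] by (simp add: Pi_def)
qed (simp_all add: cstar_subalgebraD(2)[OF assms(1)])

lemma star_hom_id: "(\<lambda>x. x) \<in> star_hom A A"
  by (auto simp: star_hom_def ring_hom_def)

lemma star_hom_compose:
  assumes "f \<in> star_hom A B" "g \<in> star_hom B C"
  shows "(\<lambda>x. g (f x)) \<in> star_hom A C"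
  unfolding star_hom_def[of A C] ring_hom_def[of A C]
  by (simp add: star_homD[OF assms(1)] star_homD[OF assms(2)])

lemma star_hom_finsum:
  assumes A: "unital_cstar_algebra A" and B: "unital_cstar_algebra B" and h: "h \<in> star_hom A B"
    and f: "\<And>i. i \<in> I \<Longrightarrow> f i \<in> carrier A"
  shows "h (\<Oplus>\<^bsub>A\<^esub>i\<in>I. f i) = (\<Oplus>\<^bsub>B\<^esub>i\<in>I. h (f i))"
proof -
  interpret A: unital_cstar_algebra A by fact
  interpret B: unital_cstar_algebra B by fact
  show ?thesis
    using f by (induct I rule: infinite_finite_induct)
      (auto simp: star_hom_zero[OF A B h] Pi_def star_homD[OF h])
qed

lemma star_hom_nat_pow:
  assumes A: "unital_cstar_algebra A" and B: "unital_cstar_algebra B" and h: "h \<in> star_hom A B"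
    and x: "x \<in> carrier A"
  shows "h (x [^]\<^bsub>A\<^esub> (l::nat)) = h x [^]\<^bsub>B\<^esub> l"
proof -
  interpret A: unital_cstar_algebra A by fact
  interpret B: unital_cstar_algebra B by fact
  show ?thesis by (induct l) (auto simp: star_homD[OF h] x)
qed

lemma cstar_subalgebra_vimage:
  assumes A: "unital_cstar_algebra A" and B: "unital_cstar_algebra B" and h: "h \<in> star_hom A B"
    and C: "cstar_subalgebra B C"
  shows "cstar_subalgebra A {x \<in> carrier A. h x \<in> C}"
proof -
  interpret A: unital_cstar_algebra A by fact
  note [simp] = star_homD[OF h] star_hom_zero[OF A B h]
  have lim: "h L \<in> C"
    if s: "\<And>m. s m \<in> carrier A" "\<And>m. h (s m) \<in> C" and L: "L \<in> carrier A" "norm_tendsto A s L" for s L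
  proof (rule cstar_subalgebraD(7)[OF C])
    show "norm_tendsto B (\<lambda>m. h (s m)) (h L)"
      by (rule star_hom_norm_tendsto[OF A B h s(1) L])
  qed (use s L in simp_all)
  show ?thesis
    unfolding cstar_subalgebra_def
  proof (intro conjI ballI allI impI)
    fix s L assume "(\<forall>m. s m \<in> {x \<in> carrier A. h x \<in> C}) \<and> L \<in> carrier A \<and> norm_tendsto A s L"
    then show "L \<in> {x \<in> carrier A. h x \<in> C}" using lim[of s L] by simp
  qed (auto intro: cstar_subalgebraD(2-6)[OF C])
qed

text \<open>
  The condition on the adjoint makes the set closed under \<open>star\<close>; it does not follow from the
  other one in general.
\<close>

lemma cstar_subalgebra_intertwiner:
  assumes A: "unital_cstar_algebra A" and B: "unital_cstar_algebra B"
    and f: "f \<in> star_hom A B" and g: "g \<in> star_hom A B" and t: "t \<in> carrier B"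
  shows "cstar_subalgebra A {x \<in> carrier A.
    f x \<otimes>\<^bsub>B\<^esub> t = t \<otimes>\<^bsub>B\<^esub> g x \<and> star B (f x) \<otimes>\<^bsub>B\<^esub> t = t \<otimes>\<^bsub>B\<^esub> star B (g x)}" (is "cstar_subalgebra A ?E")
proof -
  interpret A: unital_cstar_algebra A by fact
  interpret B: unital_cstar_algebra B by fact
  note [simp] = star_homD[OF f] star_homD[OF g] star_hom_zero[OF A B f] star_hom_zero[OF A B g] t
  have lim: "L \<in> ?E" if s: "\<And>m. s m \<in> ?E" and L: "L \<in> carrier A" "norm_tendsto A s L" for s L
  proof -
    have sc: "\<And>m. s m \<in> carrier A" using s by auto
    note f_lim = star_hom_norm_tendsto[OF A B f sc L] and g_lim = star_hom_norm_tendsto[OF A B g sc L]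
    have "f L \<otimes>\<^bsub>B\<^esub> t = t \<otimes>\<^bsub>B\<^esub> g L"
    proof (rule B.norm_tendsto_unique[of "\<lambda>m. f (s m) \<otimes>\<^bsub>B\<^esub> t"])
      show "norm_tendsto B (\<lambda>m. f (s m) \<otimes>\<^bsub>B\<^esub> t) (f L \<otimes>\<^bsub>B\<^esub> t)"
        using sc L f_lim by (intro B.norm_tendsto_mult B.norm_tendsto_const) auto
      have "norm_tendsto B (\<lambda>m. t \<otimes>\<^bsub>B\<^esub> g (s m)) (t \<otimes>\<^bsub>B\<^esub> g L)"
        using sc L g_lim by (intro B.norm_tendsto_mult B.norm_tendsto_const) auto
      moreover have "(\<lambda>m. t \<otimes>\<^bsub>B\<^esub> g (s m)) = (\<lambda>m. f (s m) \<otimes>\<^bsub>B\<^esub> t)" using s by auto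
      ultimately show "norm_tendsto B (\<lambda>m. f (s m) \<otimes>\<^bsub>B\<^esub> t) (t \<otimes>\<^bsub>B\<^esub> g L)" by simp
    qed (use sc L in auto)
    moreover have "star B (f L) \<otimes>\<^bsub>B\<^esub> t = t \<otimes>\<^bsub>B\<^esub> star B (g L)"
    proof (rule B.norm_tendsto_unique[of "\<lambda>m. star B (f (s m)) \<otimes>\<^bsub>B\<^esub> t"])
      show "norm_tendsto B (\<lambda>m. star B (f (s m)) \<otimes>\<^bsub>B\<^esub> t) (star B (f L) \<otimes>\<^bsub>B\<^esub> t)"
        using sc L f_lim by (intro B.norm_tendsto_mult B.norm_tendsto_star B.norm_tendsto_const) auto
      have "norm_tendsto B (\<lambda>m. t \<otimes>\<^bsub>B\<^esub> star B (g (s m))) (t \<otimes>\<^bsub>B\<^esub> star B (g L))"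
        using sc L g_lim by (intro B.norm_tendsto_mult B.norm_tendsto_star B.norm_tendsto_const) auto
      moreover have "(\<lambda>m. t \<otimes>\<^bsub>B\<^esub> star B (g (s m))) = (\<lambda>m. star B (f (s m)) \<otimes>\<^bsub>B\<^esub> t)"
        using s by auto
      ultimately show "norm_tendsto B (\<lambda>m. star B (f (s m)) \<otimes>\<^bsub>B\<^esub> t) (t \<otimes>\<^bsub>B\<^esub> star B (g L))"
        by simp
    qed (use sc L in auto)
    ultimately show ?thesis using L by simp
  qed
  have mult: "x \<otimes>\<^bsub>A\<^esub> y \<in> ?E" if x: "x \<in> ?E" and y: "y \<in> ?E" for x y
  proof -
    have c: "x \<in> carrier A" "y \<in> carrier A" using x y by auto
    have "f (x \<otimes>\<^bsub>A\<^esub> y) \<otimes>\<^bsub>B\<^esub> t = f x \<otimes>\<^bsub>B\<^esub> (f y \<otimes>\<^bsub>B\<^esub> t)" using c by (simp add: B.m_assoc)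
    also have "\<dots> = (f x \<otimes>\<^bsub>B\<^esub> t) \<otimes>\<^bsub>B\<^esub> g y" using y c by (simp add: B.m_assoc)
    also have "\<dots> = t \<otimes>\<^bsub>B\<^esub> g (x \<otimes>\<^bsub>A\<^esub> y)" using x c by (simp add: B.m_assoc)
    finally have 1: "f (x \<otimes>\<^bsub>A\<^esub> y) \<otimes>\<^bsub>B\<^esub> t = t \<otimes>\<^bsub>B\<^esub> g (x \<otimes>\<^bsub>A\<^esub> y)" .
    have "star B (f (x \<otimes>\<^bsub>A\<^esub> y)) \<otimes>\<^bsub>B\<^esub> t = star B (f y) \<otimes>\<^bsub>B\<^esub> (star B (f x) \<otimes>\<^bsub>B\<^esub> t)"
      using c by (simp add: B.m_assoc)
    also have "\<dots> = (star B (f y) \<otimes>\<^bsub>B\<^esub> t) \<otimes>\<^bsub>B\<^esub> star B (g x)" using x c by (simp add: B.m_assoc)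
    also have "\<dots> = t \<otimes>\<^bsub>B\<^esub> star B (g (x \<otimes>\<^bsub>A\<^esub> y))" using y c by (simp add: B.m_assoc)
    finally show ?thesis using 1 c by simp
  qed
  show ?thesis
    unfolding cstar_subalgebra_def
  proof (intro conjI ballI allI impI)
    fix x y assume "x \<in> ?E" "y \<in> ?E"
    then show "x \<otimes>\<^bsub>A\<^esub> y \<in> ?E" by (rule mult)
  next
    fix s L assume "(\<forall>m. s m \<in> ?E) \<and> L \<in> carrier A \<and> norm_tendsto A s L"
    then show "L \<in> ?E" using lim[of s L] by blast
  qed (auto simp: B.l_distr B.r_distr)
qed

lemma cstar_subalgebra_equalizer:
  assumes A: "unital_cstar_algebra A" and B: "unital_cstar_algebra B"
    and f: "f \<in> star_hom A B" and g: "g \<in> star_hom A B"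
  shows "cstar_subalgebra A {x \<in> carrier A. f x = g x}"
proof -
  interpret B: unital_cstar_algebra B by fact
  have "{x \<in> carrier A. f x = g x} = {x \<in> carrier A. f x \<otimes>\<^bsub>B\<^esub> \<one>\<^bsub>B\<^esub> = \<one>\<^bsub>B\<^esub> \<otimes>\<^bsub>B\<^esub> g x \<and>
      star B (f x) \<otimes>\<^bsub>B\<^esub> \<one>\<^bsub>B\<^esub> = \<one>\<^bsub>B\<^esub> \<otimes>\<^bsub>B\<^esub> star B (g x)}"
    using star_homD(1)[OF f] star_homD(1)[OF g] by auto
  then show ?thesis using cstar_subalgebra_intertwiner[OF A B f g, of "\<one>\<^bsub>B\<^esub>"] by simp
qed

lemma cstar_subalgebra_range:
  assumes A: "unital_cstar_algebra A" and B: "unital_cstar_algebra B" and h: "h \<in> star_hom A B"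
    and below: "\<And>x. x \<in> carrier A \<Longrightarrow> cnorm A x \<le> cnorm B (h x)"
  shows "cstar_subalgebra B (h ` carrier A)"
proof -
  interpret A: unital_cstar_algebra A by fact
  interpret B: unital_cstar_algebra B by fact
  note hD = star_homD[OF h]
  have lim: "L \<in> h ` carrier A"
    if s: "\<And>m. s m \<in> h ` carrier A" and L: "L \<in> carrier B" "norm_tendsto B s L" for s L
  proof -
    from s have "\<forall>m. \<exists>x. x \<in> carrier A \<and> s m = h x" by blast
    then obtain t where t: "\<And>m. t m \<in> carrier A" "\<And>m. s m = h (t m)" by metis
    have "norm_Cauchy B s"
      using t hD(1) L by (intro B.norm_tendsto_imp_Cauchy) auto
    moreover have "cnorm A (t p \<ominus>\<^bsub>A\<^esub> t q) \<le> cnorm B (s p \<ominus>\<^bsub>B\<^esub> s q)" for p q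
      using below[of "t p \<ominus>\<^bsub>A\<^esub> t q"] t star_hom_diff[OF A B h, of "t p" "t q"] by simp
    ultimately have "norm_Cauchy A t"
      unfolding norm_Cauchy_def by (meson le_less_trans)
    then obtain M where M: "M \<in> carrier A" "norm_tendsto A t M"
      using A.norm_complete[of t] t by auto
    have "norm_tendsto B s (h M)"
      using star_hom_norm_tendsto[OF A B h t(1) M] by (simp only: t(2)[symmetric])
    then have "L = h M"
      using L M hD(1) t by (intro B.norm_tendsto_unique[of s]) auto
    then show ?thesis using M by blast
  qed
  show ?thesis
    unfolding cstar_subalgebra_def
  proof (intro conjI ballI allI impI)
    show "\<zero>\<^bsub>B\<^esub> \<in> h ` carrier A"
      by (metis A.zero_closed image_eqI star_hom_zero[OF A B h])
  next
    fix x y assume "x \<in> h ` carrier A" "y \<in> h ` carrier A"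
    then show "x \<oplus>\<^bsub>B\<^esub> y \<in> h ` carrier A" "x \<otimes>\<^bsub>B\<^esub> y \<in> h ` carrier A"
      by (auto simp flip: hD(2) hD(3))
  next
    fix x c assume "x \<in> h ` carrier A"
    then show "star B x \<in> h ` carrier A" "c \<odot>\<^bsub>B\<^esub> x \<in> h ` carrier A"
      by (auto simp flip: hD(5) hD(6))
  next
    fix s L assume "(\<forall>m. s m \<in> h ` carrier A) \<and> L \<in> carrier B \<and> norm_tendsto B s L"
    then show "L \<in> h ` carrier A" using lim[of s L] by blast
  qed (use hD(1) in auto)
qed

text \<open>
  Thanks to this, a closed subspace \<open>D\<close> is invariant under a whole C*-algebra as soon as it is
  invariant under generators and their adjoints.
\<close>

lemma (in unital_cstar_algebra) cstar_subalgebra_multiplier: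
  assumes D: "D \<subseteq> carrier A" "\<zero> \<in> D"
    and add: "\<And>x y. \<lbrakk>x \<in> D; y \<in> D\<rbrakk> \<Longrightarrow> x \<oplus> y \<in> D"
    and smult: "\<And>c x. x \<in> D \<Longrightarrow> c \<odot> x \<in> D"
    and lim: "\<And>s L. \<lbrakk>\<And>m. s m \<in> D; L \<in> carrier A; norm_tendsto A s L\<rbrakk> \<Longrightarrow> L \<in> D"
  shows "cstar_subalgebra A {x \<in> carrier A. \<forall>y\<in>D. x \<otimes> y \<in> D \<and> star A x \<otimes> y \<in> D}"
    (is "cstar_subalgebra A ?M")
proof -
  have limM: "L \<in> ?M" if s: "\<And>m. s m \<in> ?M" and L: "L \<in> carrier A" "norm_tendsto A s L" for s L
  proof -
    have sc: "\<And>m. s m \<in> carrier A" using s by auto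
    have "L \<otimes> y \<in> D \<and> star A L \<otimes> y \<in> D" if y: "y \<in> D" for y
    proof
      have yc: "y \<in> carrier A" using y D by auto
      show "L \<otimes> y \<in> D"
      proof (rule lim)
        show "norm_tendsto A (\<lambda>m. s m \<otimes> y) (L \<otimes> y)"
          using sc yc L by (intro norm_tendsto_mult norm_tendsto_const) auto
      qed (use s y yc L in auto)
      show "star A L \<otimes> y \<in> D"
      proof (rule lim)
        show "norm_tendsto A (\<lambda>m. star A (s m) \<otimes> y) (star A L \<otimes> y)"
          using sc yc L by (intro norm_tendsto_mult norm_tendsto_star norm_tendsto_const) auto
      qed (use s y yc L in auto)
    qed
    then show ?thesis using L by auto
  qed
  show ?thesis
    unfolding cstar_subalgebra_def
  proof (intro conjI ballI allI impI)
    fix x y assume "x \<in> ?M" "y \<in> ?M"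
    then show "x \<oplus> y \<in> ?M" "x \<otimes> y \<in> ?M"
      using D add by (auto simp: l_distr m_assoc subset_iff)
  next
    fix s L assume "(\<forall>m. s m \<in> ?M) \<and> L \<in> carrier A \<and> norm_tendsto A s L"
    then show "L \<in> ?M" using limM[of s L] by blast
  qed (use D smult in \<open>auto simp: subset_iff\<close>)
qed

lemma (in unital_cstar_algebra) conjugation_star_hom:
  assumes u: "u \<in> carrier A" "star A u \<otimes> u = \<one>" "u \<otimes> star A u = \<one>"
  shows "(\<lambda>x. u \<otimes> x \<otimes> star A u) \<in> star_hom A A"
proof -
  have uu: "star A u \<otimes> (u \<otimes> x) = x" if "x \<in> carrier A" for x
    using u that by (simp flip: m_assoc)
  show ?thesis
    unfolding star_hom_def ring_hom_def
    using u by (auto simp: m_assoc l_distr r_distr uu)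
qed

section \<open>Cuntz families\<close>

locale cuntz_isometries = unital_cstar_algebra A for A :: "'a cstar_algebra" (structure) +
  fixes n :: nat and S :: "nat \<Rightarrow> 'a"
  assumes family: "cuntz_family A n S"
begin

lemma S_closed [simp]: "k \<in> {1..n} \<Longrightarrow> S k \<in> carrier A"
  and S_isometry [simp]: "k \<in> {1..n} \<Longrightarrow> star A (S k) \<otimes> S k = \<one>"
  and S_sum: "(\<Oplus>k\<in>{1..n}. S k \<otimes> star A (S k)) = \<one>"
  using family by (auto simp: cuntz_family_def)

text \<open>
  Memberships in the index set stay in the form \<open>k \<in> {1..n}\<close>, in which \<open>S_closed\<close> discharges the
  side conditions of the laws on finite sums.
\<close>

declare atLeastAtMost_iff [simp del]

text \<open>
  Put \<open>z k = S\<^sub>i\<^sup>* S\<^sub>k S\<^sub>k\<^sup>* S\<^sub>i\<close>. Then \<open>\<parallel>1 - 2 z k\<parallel> \<le> 1\<close>, since \<open>1 - 2 S\<^sub>k S\<^sub>k\<^sup>*\<close> is unitary and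
  \<open>S\<^sub>i\<close> is an isometry. All \<open>z k\<close> add up to \<open>S\<^sub>i\<^sup>* S\<^sub>i = 1 = z i\<close>, so those with \<open>k \<noteq> i\<close> add up to zero.
  Hence the sum of the \<open>N\<close> elements \<open>1 - 2 z k\<close> with \<open>k \<noteq> i, m\<close> is \<open>N + 2 z m\<close> and has norm at
  most \<open>N\<close>. So \<open>1 + t z m\<close> and \<open>1 - t z m\<close> have norm at most one for \<open>t = 2 / (N + 1)\<close>, and
  extremality of the unit forces \<open>z m = (S\<^sub>m\<^sup>* S\<^sub>i)\<^sup>* (S\<^sub>m\<^sup>* S\<^sub>i) = 0\<close>.
\<close>

lemma S_orthogonal:
  assumes i: "i \<in> {1..n}" and m: "m \<in> {1..n}" and "m \<noteq> i"
  shows "star A (S m) \<otimes> S i = \<zero>"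
proof -
  define P where "P k = S k \<otimes> star A (S k)" for k
  define z where "z k = star A (S i) \<otimes> (P k \<otimes> S i)" for k
  have Pc [simp]: "P k \<in> carrier A" if "k \<in> {1..n}" for k using that by (simp add: P_def)
  have zc [simp]: "z k \<in> carrier A" if "k \<in> {1..n}" for k using that i by (simp add: z_def)
  have PP: "P k \<otimes> P k = P k" if k: "k \<in> {1..n}" for k
  proof -
    have "P k \<otimes> P k = S k \<otimes> (star A (S k) \<otimes> S k) \<otimes> star A (S k)"
      using k by (simp add: P_def m_assoc del: S_isometry)
    then show ?thesis using k by (simp add: P_def)
  qed
  have nS: "cnorm A (S i) \<le> 1" using i by (intro norm_isometry_le) auto
  have nz: "cnorm A (\<one> \<ominus> 2 \<odot> z k) \<le> 1" if k: "k \<in> {1..n}" for k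
  proof -
    define u where "u = \<one> \<ominus> 2 \<odot> P k"
    have u: "u \<in> carrier A" "star A u = u" using k by (auto simp: u_def P_def)
    have "u \<otimes> u = \<one> \<oplus> (((-2) \<odot> P k \<oplus> (-2) \<odot> P k) \<oplus> 4 \<odot> P k)"
      using k by (simp add: u_def diff_eq_smult l_distr r_distr PP a_assoc smult_add)
    also have "((-2) \<odot> P k \<oplus> (-2) \<odot> P k) \<oplus> 4 \<odot> P k = \<zero>"
      using k by (simp flip: add_smult)
    finally have "cnorm A u \<le> 1" using u by (intro norm_isometry_le) auto
    have "\<one> \<ominus> 2 \<odot> z k = star A (S i) \<otimes> (u \<otimes> S i)"
      using k i by (simp add: u_def z_def diff_eq_smult l_distr r_distr)
    then have "cnorm A (\<one> \<ominus> 2 \<odot> z k) \<le> cnorm A (S i) * (cnorm A u * cnorm A (S i))"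
      using norm_mult_le[of "star A (S i)" "u \<otimes> S i"] norm_mult_le[of u "S i"] i u
      by (smt (verit) m_closed mult_left_mono norm_nonneg norm_star star_closed S_closed)
    also have "\<dots> \<le> 1 * (1 * 1)"
      using nS \<open>cnorm A u \<le> 1\<close> i u by (intro mult_mono mult_nonneg_nonneg norm_nonneg) auto
    finally show ?thesis by simp
  qed
  define J where "J = {1..n} - {i, m}"
  have J: "finite J" "i \<notin> insert m J" "m \<notin> J" "{1..n} = insert i (insert m J)"
    using i m \<open>m \<noteq> i\<close> by (auto simp: J_def)
  have Jn: "k \<in> {1..n}" if "k \<in> J" for k using that by (simp add: J_def)
  define w where "w = (\<Oplus>k\<in>J. z k)"
  have wc: "w \<in> carrier A" using Jn by (auto simp: w_def)
  have "(\<Oplus>k\<in>{1..n}. z k) = star A (S i) \<otimes> ((\<Oplus>k\<in>{1..n}. P k) \<otimes> S i)"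
    using i by (simp add: z_def mult_finsum finsum_mult)
  then have "(\<Oplus>k\<in>{1..n}. z k) = \<one>"
    using S_sum i by (simp add: P_def)
  moreover have "(\<Oplus>k\<in>{1..n}. z k) = z i \<oplus> (z m \<oplus> w)"
    unfolding J(4) w_def using J Jn i m by (subst finsum_insert) (auto simp: Pi_def)
  moreover have "z i = \<one>"
    using i by (simp add: z_def P_def m_assoc)
  ultimately have "\<one> \<oplus> (z m \<oplus> w) = \<one>" by simp
  then have zmw: "z m \<oplus> w = \<zero>"
    using r_neg1[of \<one> "z m \<oplus> w"] m wc by (simp add: l_neg)
  define N where "N = card J"
  have "(\<Oplus>k\<in>J. \<one> \<ominus> 2 \<odot> z k) = complex_of_nat N \<odot> \<one> \<oplus> (-2) \<odot> w"
  proof -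
    have "(\<Oplus>k\<in>J. \<one> \<ominus> 2 \<odot> z k) = (\<Oplus>k\<in>J. 1 \<odot> \<one> \<oplus> (-2) \<odot> z k)"
      using Jn by (intro finsum_cong') (auto simp: diff_eq_smult)
    also have "\<dots> = (\<Oplus>k\<in>J. 1 \<odot> \<one>) \<oplus> (\<Oplus>k\<in>J. (-2) \<odot> z k)"
      using Jn by (intro finsum_addf) auto
    also have "(\<Oplus>k\<in>J. 1 \<odot> \<one>) = complex_of_nat N \<odot> \<one>"
      by (subst finsum_smult_const) (simp_all add: N_def)
    also have "(\<Oplus>k\<in>J. (-2) \<odot> z k) = (-2) \<odot> w"
      unfolding w_def using Jn by (intro smult_finsum[symmetric]) auto
    finally show ?thesis .
  qed
  also have "(-2) \<odot> w = 2 \<odot> z m"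
  proof -
    have "z m = (-1) \<odot> w" using zmw m wc by (simp add: minus_equality flip: minus_eq_smult)
    then show ?thesis using wc by simp
  qed
  finally have sum: "(\<Oplus>k\<in>J. \<one> \<ominus> 2 \<odot> z k) = complex_of_nat N \<odot> \<one> \<oplus> 2 \<odot> z m" .
  have "cnorm A (\<Oplus>k\<in>J. \<one> \<ominus> 2 \<odot> z k) \<le> (\<Sum>k\<in>J. 1)"
    using Jn nz by (intro order_trans[OF norm_finsum_le] sum_mono) auto
  then have N1: "cnorm A (complex_of_nat N \<odot> \<one> \<oplus> 2 \<odot> z m) \<le> N"
    by (simp add: sum N_def)
  define t where "t = 2 / (real N + 1)"
  have t: "0 < t" "t \<le> 2" "t * (real N + 1) = 2" by (auto simp: t_def field_simps)
  define b where "b = complex_of_real t \<odot> z m"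
  have b: "b \<in> carrier A" "star A b = b"
    using m i by (auto simp: b_def z_def P_def m_assoc)
  have "b = \<zero>"
  proof (rule selfadjoint_eq_zero_of_norm_one_pm[OF b])
    have "\<one> \<oplus> b = complex_of_real (t / 2) \<odot> (\<one> \<oplus> (complex_of_nat N \<odot> \<one> \<oplus> 2 \<odot> z m))"
    proof -
      have "complex_of_real (t / 2) \<odot> (\<one> \<oplus> (complex_of_nat N \<odot> \<one> \<oplus> 2 \<odot> z m))
          = complex_of_real (t * (real N + 1) / 2) \<odot> \<one> \<oplus> b"
        using m add_smult[of \<one> "complex_of_real (t/2)" "complex_of_real (t/2) * N"]
        by (simp add: b_def smult_add a_assoc[symmetric] algebra_simps add_divide_distrib)
      then show ?thesis using t by simp
    qed
    then have "cnorm A (\<one> \<oplus> b) = t / 2 * cnorm A (\<one> \<oplus> (complex_of_nat N \<odot> \<one> \<oplus> 2 \<odot> z m))"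
      using m t by (simp add: norm_smult)
    also have "\<dots> \<le> t / 2 * (1 + N)"
      using m t N1 norm_one_le
      by (intro mult_left_mono order_trans[OF norm_triangle] add_mono) auto
    finally show "cnorm A (\<one> \<oplus> b) \<le> 1" using t by (simp add: algebra_simps)
    have "\<one> \<ominus> b = complex_of_real (1 - t/2) \<odot> \<one> \<oplus> complex_of_real (t/2) \<odot> (\<one> \<ominus> 2 \<odot> z m)"
      using m add_smult[of \<one> "complex_of_real (1 - t/2)" "complex_of_real (t/2)"]
      by (simp add: b_def smult_add diff_eq_smult a_assoc[symmetric])
    also have "cnorm A \<dots> \<le> (1 - t/2) * 1 + t/2 * 1"
      using m t nz[OF m] norm_one_le
      by (intro order_trans[OF norm_triangle] add_mono)
        (auto simp: norm_smult simp flip: of_real_diff of_real_divide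
          intro!: mult_left_le mult_le_one)
    finally show "cnorm A (\<one> \<ominus> b) \<le> 1" by simp
  qed
  then have "z m = \<zero>"
    using t m smult_smult[of "z m" "complex_of_real (1/t)" "complex_of_real t"]
    by (simp add: b_def)
  then have "star A (star A (S m) \<otimes> S i) \<otimes> (star A (S m) \<otimes> S i) = \<zero>"
    using i m by (simp add: z_def P_def m_assoc)
  then have "cnorm A (star A (S m) \<otimes> S i) = 0"
    using i m cstar_identity[of "star A (S m) \<otimes> S i"] by simp
  then show ?thesis using i m by (simp add: norm_eq_zero_iff)
qed

lemma star_S_S:
  "\<lbrakk>j \<in> {1..n}; k \<in> {1..n}\<rbrakk> \<Longrightarrow> star A (S j) \<otimes> S k = of_bool (j = k) \<odot> \<one>"
  using S_orthogonal[of k j] by (cases "k = j") auto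

lemma eq_on_S:
  assumes "x \<in> carrier A" "y \<in> carrier A" "\<And>k. k \<in> {1..n} \<Longrightarrow> x \<otimes> S k = y \<otimes> S k"
  shows "x = y"
proof -
  have "x = x \<otimes> (\<Oplus>k\<in>{1..n}. S k \<otimes> star A (S k))" using assms S_sum by simp
  also have "\<dots> = (\<Oplus>k\<in>{1..n}. x \<otimes> S k \<otimes> star A (S k))"
    using assms(1) by (simp add: mult_finsum) (intro finsum_cong', auto simp: m_assoc)
  also have "\<dots> = (\<Oplus>k\<in>{1..n}. y \<otimes> S k \<otimes> star A (S k))"
    using assms by (intro finsum_cong') auto
  also have "\<dots> = y \<otimes> (\<Oplus>k\<in>{1..n}. S k \<otimes> star A (S k))"
    using assms(2) by (simp add: mult_finsum) (intro finsum_cong', auto simp: m_assoc)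
  finally show ?thesis using assms S_sum by simp
qed

definition lincomb :: "(nat \<Rightarrow> complex) \<Rightarrow> 'a" where
  "lincomb c = (\<Oplus>k\<in>{1..n}. c k \<odot> S k)"

lemma lincomb_closed [simp]: "lincomb c \<in> carrier A"
  by (auto simp: lincomb_def)

lemma smult_lincomb: "d \<odot> lincomb c = lincomb (\<lambda>k. d * c k)"
  by (auto simp: lincomb_def smult_finsum intro!: finsum_cong')

lemma star_S_lincomb:
  assumes "j \<in> {1..n}"
  shows "star A (S j) \<otimes> lincomb c = c j \<odot> \<one>"
proof -
  have "star A (S j) \<otimes> lincomb c = (\<Oplus>k\<in>{1..n}. of_bool (k = j) \<odot> (c k \<odot> \<one>))"
    using assms by (auto simp: lincomb_def mult_finsum star_S_S eq_commute[of j] mult.commute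
        intro!: finsum_cong')
  also have "\<dots> = c j \<odot> \<one>" using assms by (intro finsum_delta) auto
  finally show ?thesis .
qed

lemma star_lincomb_S: "j \<in> {1..n} \<Longrightarrow> star A (lincomb c) \<otimes> S j = cnj (c j) \<odot> \<one>"
  using arg_cong[OF star_S_lincomb, of j "star A" c] by simp

lemma star_lincomb_lincomb: "star A (lincomb c) \<otimes> lincomb d = (\<Sum>k\<in>{1..n}. cnj (c k) * d k) \<odot> \<one>"
proof -
  have "star A (lincomb c) \<otimes> lincomb d = (\<Oplus>k\<in>{1..n}. (cnj (c k) * d k) \<odot> \<one>)"
    by (auto simp: lincomb_def[of d] mult_finsum star_lincomb_S mult.commute intro!: finsum_cong')
  then show ?thesis by (simp add: finsum_smult_const)
qed

lemma finsum_smult_lincomb: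
  assumes "finite I"
  shows "(\<Oplus>l\<in>I. d l \<odot> lincomb (c l)) = lincomb (\<lambda>k. \<Sum>l\<in>I. d l * c l k)"
proof -
  have "(\<Oplus>l\<in>I. d l \<odot> lincomb (c l)) = (\<Oplus>l\<in>I. \<Oplus>k\<in>{1..n}. (d l * c l k) \<odot> S k)"
    by (simp only: smult_lincomb) (simp only: lincomb_def)
  also have "\<dots> = (\<Oplus>k\<in>{1..n}. \<Oplus>l\<in>I. (d l * c l k) \<odot> S k)"
    using assms by (intro finsum_swap) auto
  also have "\<dots> = lincomb (\<lambda>k. \<Sum>l\<in>I. d l * c l k)"
    by (auto simp: lincomb_def finsum_smult_const intro!: finsum_cong')
  finally show ?thesis .
qed

lemma lincomb_delta: "j \<in> {1..n} \<Longrightarrow> lincomb (\<lambda>k. of_bool (k = j)) = S j"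
  by (simp add: lincomb_def finsum_delta)

lemma lincomb_cong: "(\<And>k. k \<in> {1..n} \<Longrightarrow> c k = d k) \<Longrightarrow> lincomb c = lincomb d"
  by (auto simp: lincomb_def intro!: finsum_cong')

lemma unitary_matrix_family:
  assumes row: "\<And>l. l \<in> {1..n} \<Longrightarrow> (\<Sum>k\<in>{1..n}. cnj (c l k) * c l k) = 1"
    and col: "\<And>j k. \<lbrakk>j \<in> {1..n}; k \<in> {1..n}\<rbrakk> \<Longrightarrow>
      (\<Sum>l\<in>{1..n}. cnj (c l j) * c l k) = of_bool (k = j)"
  shows "cuntz_family A n (\<lambda>l. lincomb (c l))"
proof -
  have "(\<Oplus>l\<in>{1..n}. lincomb (c l) \<otimes> star A (lincomb (c l))) = \<one>"
  proof (rule eq_on_S)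
    fix j assume j: "j \<in> {1..n}"
    have "(\<Oplus>l\<in>{1..n}. lincomb (c l) \<otimes> star A (lincomb (c l))) \<otimes> S j
        = (\<Oplus>l\<in>{1..n}. cnj (c l j) \<odot> lincomb (c l))"
      using j by (auto simp: finsum_mult m_assoc star_lincomb_S intro!: finsum_cong')
    also have "\<dots> = S j"
    proof -
      have "(\<Oplus>l\<in>{1..n}. cnj (c l j) \<odot> lincomb (c l)) = lincomb (\<lambda>k. of_bool (k = j))"
        unfolding finsum_smult_lincomb[OF finite_atLeastAtMost]
        using j by (intro lincomb_cong col)
      then show ?thesis using j by (simp add: lincomb_delta)
    qed
    finally show "(\<Oplus>l\<in>{1..n}. lincomb (c l) \<otimes> star A (lincomb (c l))) \<otimes> S j = \<one> \<otimes> S j"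
      using j by simp
  qed auto
  then show ?thesis
    by (simp add: cuntz_family_def star_lincomb_lincomb row del: One_nat_def)
qed

end

lemma (in unital_cstar_algebra) unitary_between_families:
  fixes P Q :: "nat \<Rightarrow> 'a"
  assumes P: "cuntz_family A n P" and Q: "cuntz_family A n Q"
  defines "W \<equiv> (\<Oplus>l\<in>{1..n}. P l \<otimes> star A (Q l))"
  shows "W \<in> carrier A" and "\<And>j. j \<in> {1..n} \<Longrightarrow> W \<otimes> Q j = P j"
    and "star A W \<otimes> W = \<one>" and "W \<otimes> star A W = \<one>"
proof -
  interpret P: cuntz_isometries A n P by (unfold_locales) (rule P)
  interpret Q: cuntz_isometries A n Q by (unfold_locales) (rule Q)
  show W: "W \<in> carrier A" by (auto simp: W_def)
  show WQ: "W \<otimes> Q j = P j" if j: "j \<in> {1..n}" for j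
  proof -
    have "W \<otimes> Q j = (\<Oplus>l\<in>{1..n}. of_bool (l = j) \<odot> P l)"
      using j by (auto simp: W_def finsum_mult m_assoc Q.star_S_S intro!: finsum_cong')
    also have "\<dots> = P j" using j by (intro finsum_delta) auto
    finally show ?thesis .
  qed
  have WP: "star A W \<otimes> P j = Q j" if j: "j \<in> {1..n}" for j
  proof -
    have "star A W \<otimes> P j = (\<Oplus>l\<in>{1..n}. of_bool (l = j) \<odot> Q l)"
      using j by (auto simp: W_def star_finsum finsum_mult m_assoc P.star_S_S
          intro!: finsum_cong')
    also have "\<dots> = Q j" using j by (intro finsum_delta) auto
    finally show ?thesis .
  qed
  show "star A W \<otimes> W = \<one>"
    by (rule Q.eq_on_S) (use W in \<open>auto simp: m_assoc WQ WP\<close>)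
  show "W \<otimes> star A W = \<one>"
    by (rule P.eq_on_S) (use W in \<open>auto simp: m_assoc WQ WP\<close>)
qed

section \<open>Roots of unity\<close>

definition unity_root :: "nat \<Rightarrow> int \<Rightarrow> complex" where
  "unity_root n m = cis (2 * pi * of_int m / of_nat n)"

lemma unity_root_0 [simp]: "unity_root n 0 = 1"
  by (simp add: unity_root_def)

lemma unity_root_add: "unity_root n (l + m) = unity_root n l * unity_root n m"
  by (simp add: unity_root_def cis_mult add_divide_distrib ring_distribs)

lemma cnj_unity_root [simp]: "cnj (unity_root n m) = unity_root n (- m)"
  by (simp add: unity_root_def cis_cnj)

lemma unity_root_power: "unity_root n m ^ l = unity_root n (int l * m)"
  by (induct l) (simp_all add: ring_distribs unity_root_add)

lemma unity_root_eq_1_iff: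
  assumes "n > 0"
  shows "unity_root n m = 1 \<longleftrightarrow> int n dvd m"
proof
  assume "unity_root n m = 1"
  then have "cos (2 * pi * of_int m / of_nat n) = 1"
    by (simp add: unity_root_def complex_eq_iff)
  then obtain q :: int where "2 * pi * of_int m / of_nat n = of_int q * 2 * pi"
    by (auto simp: cos_one_2pi_int)
  then have "real_of_int m = of_int q * real n"
    using assms by (simp add: field_simps)
  then have "real_of_int m = real_of_int (q * int n)" by simp
  then have "m = q * int n" by (simp only: of_int_eq_iff)
  then show "int n dvd m" by simp
next
  assume "int n dvd m"
  then obtain q where "m = int n * q" ..
  then have "2 * pi * of_int m / of_nat n = 2 * pi * real_of_int q" using assms by simp
  then show "unity_root n m = 1"
    unfolding unity_root_def by (simp only: cis_multiple_2pi Ints_of_int)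
qed

lemma sum_unity_root:
  assumes "n > 0"
  shows "(\<Sum>l\<in>{1..n}. unity_root n (int l * m)) = (if int n dvd m then of_nat n else 0)"
proof -
  define z where "z = unity_root n m"
  have eq: "(\<Sum>l\<in>{1..n}. unity_root n (int l * m)) = z * (\<Sum>l<n. z ^ l)"
    by (simp add: z_def sum.atLeast1_atMost_eq sum_distrib_left flip: unity_root_power)
  show ?thesis
  proof (cases "int n dvd m")
    case True
    then have "z = 1" using assms by (simp add: z_def unity_root_eq_1_iff)
    then show ?thesis using True by (simp add: eq del: One_nat_def)
  next
    case False
    then have "z \<noteq> 1" using assms by (simp add: z_def unity_root_eq_1_iff)
    moreover have "z ^ n = 1" using assms by (simp add: z_def unity_root_power unity_root_eq_1_iff)
    ultimately show ?thesis using False by (simp add: eq geometric_sum del: One_nat_def)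
  qed
qed

lemma dvd_diff_iff_eq:
  assumes "j \<in> {1..n}" "k \<in> {1..n}"
  shows "int n dvd int k - int j \<longleftrightarrow> k = j"
  using assms zdvd_imp_le[of "int n" "int k - int j"] zdvd_imp_le[of "int n" "int j - int k"]
  by (cases k j rule: linorder_cases) (auto simp: dvd_diff_commute)

section \<open>The diagonal unitary and the Fourier families\<close>

locale cuntz_generators = cuntz_isometries +
  assumes n_pos: "n > 0"
begin

abbreviation e :: "int \<Rightarrow> complex" where "e \<equiv> unity_root n"
abbreviation v :: 'a where "v \<equiv> cuntz_v A n S"
abbreviation T :: 'a where "T \<equiv> cuntz_T A n S"
abbreviation t :: "nat \<Rightarrow> 'a" where "t l \<equiv> Ad A (v [^] l) T"

lemma e_add_n [simp]: "e (int n) = 1" "e (int n * m) = 1"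
  using n_pos by (simp_all add: unity_root_eq_1_iff)

lemma v_eq: "v = (\<Oplus>k\<in>{1..n}. e (int k) \<odot> (S k \<otimes> star A (S k)))"
  by (simp add: cuntz_v_def unity_root_def cis_conv_exp mult_ac del: One_nat_def)

lemma v_closed [simp]: "v \<in> carrier A"
  by (auto simp: v_eq)

lemma T_eq: "T = lincomb (\<lambda>k. 1 / sqrt n)"
  by (simp add: cuntz_T_def lincomb_def smult_finsum del: One_nat_def)

lemma T_closed [simp]: "T \<in> carrier A"
  by (simp add: T_eq)

lemma v_S: "k \<in> {1..n} \<Longrightarrow> v \<otimes> S k = e (int k) \<odot> S k"
proof -
  assume k: "k \<in> {1..n}"
  have "v \<otimes> S k = (\<Oplus>l\<in>{1..n}. of_bool (l = k) \<odot> (e (int l) \<odot> S l))"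
    using k by (auto simp: v_eq finsum_mult m_assoc star_S_S mult.commute intro!: finsum_cong')
  also have "\<dots> = e (int k) \<odot> S k" using k by (intro finsum_delta) auto
  finally show ?thesis .
qed

lemma star_v_S: "k \<in> {1..n} \<Longrightarrow> star A v \<otimes> S k = e (- int k) \<odot> S k"
proof -
  assume k: "k \<in> {1..n}"
  have "star A v \<otimes> S k = (\<Oplus>l\<in>{1..n}. of_bool (l = k) \<odot> (e (- int l) \<odot> S l))"
    using k by (auto simp: v_eq star_finsum finsum_mult m_assoc star_S_S mult.commute
        intro!: finsum_cong')
  also have "\<dots> = e (- int k) \<odot> S k" using k by (intro finsum_delta) auto
  finally show ?thesis .
qed

lemma v_pow_S: "k \<in> {1..n} \<Longrightarrow> v [^] l \<otimes> S k = e (int l * int k) \<odot> S k"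
  by (induct l) (simp_all add: m_assoc v_S ring_distribs unity_root_add mult.commute)

lemma star_v_pow_S: "k \<in> {1..n} \<Longrightarrow> star A (v [^] l) \<otimes> S k = e (- (int l * int k)) \<odot> S k"
  unfolding star_nat_pow[OF v_closed]
  by (induct l) (simp_all add: m_assoc star_v_S ring_distribs unity_root_add[of _ "- _" "- _", symmetric]
      flip: unity_root_add)

lemma v_pow_unitary [simp]:
  fixes l :: nat
  shows "star A (v [^] l) \<otimes> v [^] l = \<one>" "v [^] l \<otimes> star A (v [^] l) = \<one>"
proof -
  have e: "e (int l * int k) * e (- (int l * int k)) = 1" for k
    by (simp flip: unity_root_add)
  then show "star A (v [^] l) \<otimes> v [^] l = \<one>"
    by (intro eq_on_S[of "star A (v [^] l) \<otimes> v [^] l" \<one>])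
       (simp_all add: m_assoc v_pow_S star_v_pow_S)
  show "v [^] l \<otimes> star A (v [^] l) = \<one>"
    using e by (intro eq_on_S[of "v [^] l \<otimes> star A (v [^] l)" \<one>])
       (simp_all add: m_assoc v_pow_S star_v_pow_S mult.commute)
qed

lemma v_unitary [simp]: "star A v \<otimes> v = \<one>" "v \<otimes> star A v = \<one>"
  using v_pow_unitary[of 1] by (simp_all del: v_pow_unitary)

lemma v_pow_n [simp]: "v [^] n = \<one>"
  by (rule eq_on_S) (simp_all add: v_pow_S)

lemma v_pow_lincomb: "v [^] l \<otimes> lincomb c = lincomb (\<lambda>k. e (int l * int k) * c k)"
  by (auto simp: lincomb_def mult_finsum v_pow_S mult.commute intro!: finsum_cong')

lemma star_v_pow_lincomb:
  "star A (v [^] l) \<otimes> lincomb c = lincomb (\<lambda>k. e (- (int l * int k)) * c k)"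
  by (auto simp: lincomb_def mult_finsum star_v_pow_S mult.commute intro!: finsum_cong')

lemma sqrt_n_mult: "complex_of_real (sqrt n) * complex_of_real (sqrt n) = of_nat n"
  by (metis of_real_mult of_real_of_nat_eq real_sqrt_mult_self abs_of_nat)

text \<open>
  The case \<open>a = 0\<close>, \<open>b = 1\<close> is the family \<open>v\<^sup>l T\<close>; for \<open>a = k\<close>, \<open>b = -1\<close> one gets the family
  \<open>v\<^sup>-\<^sup>l T\<close> up to the phases \<open>e (l k)\<close>.
\<close>

lemma fourier_family:
  fixes a b :: int
  assumes "b = 1 \<or> b = -1"
  shows "cuntz_family A n (\<lambda>l. lincomb (\<lambda>j. e (int l * (a + b * int j)) / sqrt n))"
proof (rule unitary_matrix_family)
  have prod: "cnj (e (int l * (a + b * int j)) / sqrt n) * (e (int l * (a + b * int k)) / sqrt n)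
      = e (int l * (b * (int k - int j))) / of_nat n" for l j k
  proof -
    have "e (- (int l * (a + b * int j))) * e (int l * (a + b * int k))
        = e (int l * (b * (int k - int j)))"
      unfolding unity_root_add[symmetric] by (simp add: algebra_simps)
    then show ?thesis by (simp add: sqrt_n_mult)
  qed
  show "(\<Sum>k\<in>{1..n}. cnj (e (int l * (a + b * int k)) / sqrt n)
      * (e (int l * (a + b * int k)) / sqrt n)) = 1" for l
    unfolding prod using n_pos by simp
  show "(\<Sum>l\<in>{1..n}. cnj (e (int l * (a + b * int j)) / sqrt n)
      * (e (int l * (a + b * int k)) / sqrt n)) = of_bool (k = j)"
    if "j \<in> {1..n}" "k \<in> {1..n}" for j k
    unfolding prod sum_divide_distrib[symmetric] sum_unity_root[OF n_pos]
    using assms n_pos dvd_diff_iff_eq[OF that] by (auto simp: dvd_diff_commute)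
qed

lemma t_closed [simp]: "t l \<in> carrier A"
  by (simp add: Ad_def)

text \<open>The family \<open>v\<^sup>l T\<close> is multiplied by unitaries on the right, which keeps the range projections.\<close>

lemma t_family: "cuntz_family A n t"
proof -
  define U where "U l = v [^] l \<otimes> T" for l :: nat
  have "U = (\<lambda>l. lincomb (\<lambda>j. e (int l * (0 + 1 * int j)) / sqrt n))"
    by (simp add: U_def T_eq v_pow_lincomb fun_eq_iff)
  then have U: "cuntz_family A n U" using fourier_family[of 1 0] by simp
  have Uc [simp]: "U l \<in> carrier A" for l by (simp add: U_def)
  have cancel: "star A (v [^] l) \<otimes> (v [^] l \<otimes> x) = x" if "x \<in> carrier A" for l :: nat and x
    using that by (simp flip: m_assoc)
  have t: "t l = U l \<otimes> star A (v [^] l)" for l by (simp add: Ad_def U_def)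
  have "t l \<otimes> star A (t l) = U l \<otimes> star A (U l)" for l
    by (simp add: t m_assoc cancel)
  moreover have "star A (t l) \<otimes> t l = \<one>" if "l \<in> {1..n}" for l
  proof -
    have "star A (t l) \<otimes> t l = v [^] l \<otimes> (star A (U l) \<otimes> U l) \<otimes> star A (v [^] l)"
      by (simp add: t m_assoc)
    then show ?thesis using U that by (simp add: cuntz_family_def)
  qed
  ultimately show ?thesis using U by (simp add: cuntz_family_def)
qed

lemma t_n: "t n = T"
  by (simp add: Ad_def)

lemma Ad_v_t: "v \<otimes> t l \<otimes> star A v = t (Suc l)"
proof -
  have "v [^] Suc l = v \<otimes> v [^] l" by (rule nat_pow_Suc2) simp
  then show ?thesis by (simp add: Ad_def m_assoc del: nat_pow_Suc)
qed

lemma generators_eq: "{t l | l. l \<in> {0..n-1}} = t ` {1..n}"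
proof -
  have t0: "t 0 = t n" by (simp add: Ad_def)
  show ?thesis
  proof (intro equalityI subsetI)
    fix x assume "x \<in> {t l | l. l \<in> {0..n-1}}"
    then obtain l where l: "x = t l" "l \<le> n - 1" by (auto simp: atLeastAtMost_iff)
    show "x \<in> t ` {1..n}"
    proof (cases "l = 0")
      case True
      then show ?thesis using l n_pos t0 by (intro image_eqI[of _ _ n]) (auto simp: atLeastAtMost_iff)
    next
      case False
      then show ?thesis using l by (intro image_eqI[of _ _ l]) (auto simp: atLeastAtMost_iff)
    qed
  next
    fix x assume "x \<in> t ` {1..n}"
    then obtain l where l: "x = t l" "1 \<le> l" "l \<le> n" by (auto simp: atLeastAtMost_iff)
    have "x = t (if l = n then 0 else l)" using l(1) t0 by auto
    moreover have "(if l = n then 0 else l) \<in> {0..n-1}" using l by (auto simp: atLeastAtMost_iff)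
    ultimately show "x \<in> {t l | l. l \<in> {0..n-1}}" by blast
  qed
qed

lemma T_isometry: "star A T \<otimes> T = \<one>"
proof -
  interpret t: cuntz_isometries A n t by unfold_locales (rule t_family)
  have "n \<in> {1..n}" using n_pos by (simp add: atLeastAtMost_iff)
  then show ?thesis using t.S_isometry[of n] by (simp only: t_n)
qed

text \<open>
  \<open>W k\<close> is the unitary that maps the Fourier family \<open>e (l k) v\<^sup>-\<^sup>l T\<close> to the family \<open>S l\<close>. It is
  determined by the wish that an endomorphism \<open>\<Phi>\<close> with \<open>\<Phi> (S k) = S k (W k)\<close> satisfy
  \<open>\<Phi> (t l) T = T S l\<close>: as such an endomorphism fixes \<open>v\<close>, the left-hand side is
  \<open>v\<^sup>l \<Phi>(T) v\<^sup>-\<^sup>l T\<close>, and multiplication by \<open>S\<^sub>k\<^sup>* v\<^sup>-\<^sup>l\<close> from the left turns the equation into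
  \<open>W k (v\<^sup>-\<^sup>l T) = e (- l k) S l\<close>.
\<close>

definition W :: "nat \<Rightarrow> 'a" where
  "W k = (\<Oplus>l\<in>{1..n}. S l \<otimes> star A (lincomb (\<lambda>j. e (int l * (int k + (-1) * int j)) / sqrt n)))"

lemma W_closed [simp]: "W k \<in> carrier A"
  and W_unitary: "star A (W k) \<otimes> W k = \<one>" "W k \<otimes> star A (W k) = \<one>"
  and W_fourier: "l \<in> {1..n} \<Longrightarrow>
    W k \<otimes> lincomb (\<lambda>j. e (int l * (int k + (-1) * int j)) / sqrt n) = S l"
  using unitary_between_families[OF family fourier_family[of "-1" "int k"]] unfolding W_def
  by simp_all

lemma W_v_T:
  assumes l: "l \<in> {1..n}"
  shows "W k \<otimes> (star A (v [^] l) \<otimes> T) = e (- (int l * int k)) \<odot> S l"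
proof -
  have "star A (v [^] l) \<otimes> T
      = e (- (int l * int k)) \<odot> lincomb (\<lambda>j. e (int l * (int k + (-1) * int j)) / sqrt n)"
    unfolding T_eq star_v_pow_lincomb smult_lincomb times_divide_eq_right unity_root_add[symmetric]
    by (simp add: algebra_simps)
  then show ?thesis using W_fourier[OF l, of k] l by simp
qed

lemma W_family: "cuntz_family A n (\<lambda>k. S k \<otimes> W k)"
proof -
  have cancel: "W k \<otimes> (star A (W k) \<otimes> x) = x" "star A (W k) \<otimes> (W k \<otimes> x) = x"
    "star A (S j) \<otimes> (S j \<otimes> x) = x"
    if "x \<in> carrier A" "j \<in> {1..n}" for x k j
    using that by (simp_all add: W_unitary flip: m_assoc)
  have "(\<Oplus>k\<in>{1..n}. S k \<otimes> W k \<otimes> star A (S k \<otimes> W k)) = (\<Oplus>k\<in>{1..n}. S k \<otimes> star A (S k))"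
    by (intro finsum_cong') (auto simp: m_assoc cancel)
  then show ?thesis
    unfolding cuntz_family_def S_sum by (auto simp: m_assoc cancel W_unitary)
qed

text \<open>Fourier inversion: \<open>v\<close> and \<open>T\<close> generate the Cuntz algebra.\<close>

lemma S_eq_sum:
  assumes k: "k \<in> {1..n}"
  shows "S k = (\<Oplus>l\<in>{1..n}. (e (- (int l * int k)) / sqrt n) \<odot> (v [^] l \<otimes> T))"
proof -
  have "(\<Oplus>l\<in>{1..n}. (e (- (int l * int k)) / sqrt n) \<odot> (v [^] l \<otimes> T))
      = lincomb (\<lambda>j. \<Sum>l\<in>{1..n}. e (- (int l * int k)) / sqrt n * (e (int l * int j) * (1 / sqrt n)))"
    unfolding T_eq v_pow_lincomb by (rule finsum_smult_lincomb) simp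
  also have "\<dots> = lincomb (\<lambda>j. of_bool (j = k))"
  proof (rule lincomb_cong)
    fix j assume j: "j \<in> {1..n}"
    have "e (- (int l * int k)) / sqrt n * (e (int l * int j) * (1 / sqrt n))
        = e (int l * (int j - int k)) / of_nat n" for l
    proof -
      have "e (- (int l * int k)) * e (int l * int j) = e (int l * (int j - int k))"
        unfolding unity_root_add[symmetric] by (simp add: algebra_simps)
      then show ?thesis by (simp add: sqrt_n_mult)
    qed
    then show "(\<Sum>l\<in>{1..n}. e (- (int l * int k)) / sqrt n * (e (int l * int j) * (1 / sqrt n)))
        = of_bool (j = k)"
      using n_pos by (simp add: sum_unity_root[OF n_pos] dvd_diff_iff_eq[OF k j]
          del: One_nat_def flip: sum_divide_distrib)
  qed
  finally show ?thesis using k by (simp add: lincomb_delta)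
qed

section \<open>Embedding the Cuntz algebra onto the subalgebra generated by the conjugates\<close>

lemma star_S_T: "k \<in> {1..n} \<Longrightarrow> star A (S k) \<otimes> T = complex_of_real (1 / sqrt n) \<odot> \<one>"
  by (simp add: T_eq star_S_lincomb)

lemma eq_on_star_S:
  assumes "x \<in> carrier A" "y \<in> carrier A"
    "\<And>k. k \<in> {1..n} \<Longrightarrow> star A (S k) \<otimes> x = star A (S k) \<otimes> y"
  shows "x = y"
proof -
  have "star A x \<otimes> S k = star A y \<otimes> S k" if "k \<in> {1..n}" for k
  proof -
    have "star A (star A (S k) \<otimes> x) = star A (star A (S k) \<otimes> y)"
      by (simp only: assms(3)[OF that])
    then show ?thesis using assms(1,2) that by simp
  qed
  then have "star A x = star A y" using assms(1,2) by (intro eq_on_S[of "star A x" "star A y"]) auto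
  then have "star A (star A x) = star A (star A y)" by (simp only:)
  then show ?thesis using assms(1,2) by simp
qed

context
  fixes \<Phi> :: "'a \<Rightarrow> 'a"
  assumes \<Phi>: "\<Phi> \<in> star_hom A A" and \<Phi>_S: "\<And>k. k \<in> {1..n} \<Longrightarrow> \<Phi> (S k) = S k \<otimes> W k"
begin

lemma \<Phi>_v: "\<Phi> v = v"
proof -
  have cancel: "W k \<otimes> (star A (W k) \<otimes> x) = x" if "x \<in> carrier A" for x k
    using that by (simp add: W_unitary flip: m_assoc)
  have "\<Phi> v = (\<Oplus>k\<in>{1..n}. \<Phi> (e (int k) \<odot> (S k \<otimes> star A (S k))))"
    unfolding v_eq
    by (rule star_hom_finsum[OF unital_cstar_algebra_axioms unital_cstar_algebra_axioms \<Phi>]) simp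
  also have "\<dots> = v"
    unfolding v_eq
    by (intro finsum_cong') (auto simp: star_homD[OF \<Phi>] \<Phi>_S m_assoc cancel)
  finally show ?thesis .
qed

text \<open>
  As \<open>\<Phi>\<close> fixes \<open>v\<close>, the claim amounts to \<open>\<Phi>(T) y = y S l\<close> for \<open>y = v\<^sup>-\<^sup>l T\<close>.
\<close>

lemma \<Phi>_t_T:
  assumes l: "l \<in> {1..n}"
  shows "\<Phi> (t l) \<otimes> T = T \<otimes> S l"
proof -
  note hom = unital_cstar_algebra_axioms unital_cstar_algebra_axioms \<Phi>
  define y where "y = star A (v [^] l) \<otimes> T"
  have y: "y \<in> carrier A" by (simp add: y_def)
  have \<Phi>c [simp]: "\<Phi> T \<in> carrier A" by (simp add: star_homD(1)[OF \<Phi>])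
  have "\<Phi> T \<otimes> y = y \<otimes> S l"
  proof -
    have "\<Phi> T = (\<Oplus>j\<in>{1..n}. \<Phi> (complex_of_real (1 / sqrt n) \<odot> S j))"
      unfolding T_eq lincomb_def by (rule star_hom_finsum[OF hom]) simp
    also have "\<dots> = (\<Oplus>j\<in>{1..n}. complex_of_real (1 / sqrt n) \<odot> (S j \<otimes> W j))"
      by (intro finsum_cong') (auto simp: star_homD[OF \<Phi>] \<Phi>_S)
    finally have "\<Phi> T \<otimes> y = (\<Oplus>j\<in>{1..n}. complex_of_real (1 / sqrt n) \<odot> (S j \<otimes> W j)) \<otimes> y"
      by simp
    also have "\<dots> = (\<Oplus>j\<in>{1..n}. complex_of_real (1 / sqrt n) \<odot> (S j \<otimes> W j) \<otimes> y)"
      using y by (intro finsum_mult) auto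
    also have "\<dots> = (\<Oplus>j\<in>{1..n}. (e (- (int l * int j)) / sqrt n) \<odot> (S j \<otimes> S l))"
      using y l by (intro finsum_cong') (auto simp: m_assoc W_v_T[OF l] y_def)
    also have "\<dots> = (\<Oplus>j\<in>{1..n}. (e (- (int l * int j)) / sqrt n) \<odot> S j \<otimes> S l)"
      using l by (intro finsum_cong') auto
    also have "\<dots> = (\<Oplus>j\<in>{1..n}. (e (- (int l * int j)) / sqrt n) \<odot> S j) \<otimes> S l"
      using l by (intro finsum_mult[symmetric]) auto
    also have "(\<Oplus>j\<in>{1..n}. (e (- (int l * int j)) / sqrt n) \<odot> S j) = y"
      unfolding y_def T_eq star_v_pow_lincomb by (simp add: lincomb_def del: One_nat_def)
    finally show ?thesis .
  qed
  moreover have "\<Phi> (t l) = v [^] l \<otimes> \<Phi> T \<otimes> star A (v [^] l)"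
    by (simp add: Ad_def star_homD[OF \<Phi>] star_hom_nat_pow[OF hom] \<Phi>_v)
  ultimately have "\<Phi> (t l) \<otimes> T = v [^] l \<otimes> (y \<otimes> S l)"
    by (simp add: m_assoc y_def)
  also have "\<dots> = (v [^] l \<otimes> star A (v [^] l)) \<otimes> T \<otimes> S l"
    using l by (simp add: y_def m_assoc del: v_pow_unitary)
  finally show ?thesis using l by simp
qed

text \<open>
  On generators this is the preceding lemma. For their adjoints one uses that \<open>t\<close> and \<open>S\<close> are
  both orthonormal: \<open>\<Phi> (t l)\<^sup>* T S m = \<Phi> (t l)\<^sup>* \<Phi> (t m) T\<close> equals \<open>T\<close> if \<open>l = m\<close> and vanishes otherwise,
  just as \<open>T S\<^sub>l\<^sup>* S m\<close>.
\<close>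

lemma intertwining:
  assumes gen: "cstar_generated A (S ` {1..n}) = carrier A"
    and h: "h \<in> star_hom A A" and h_S: "\<And>l. l \<in> {1..n} \<Longrightarrow> h (S l) = t l"
    and x: "x \<in> carrier A"
  shows "\<Phi> (h x) \<otimes> T = T \<otimes> x"
proof -
  interpret t: cuntz_isometries A n t by unfold_locales (rule t_family)
  note ax = unital_cstar_algebra_axioms
  note [simp] = star_homD(1)[OF \<Phi>]
  let ?E = "{x \<in> carrier A. \<Phi> (h x) \<otimes> T = T \<otimes> x \<and> star A (\<Phi> (h x)) \<otimes> T = T \<otimes> star A x}"
  have "cstar_subalgebra A ?E"
    by (rule cstar_subalgebra_intertwiner[OF ax ax star_hom_compose[OF h \<Phi>] star_hom_id]) simp
  moreover have "S l \<in> ?E" if l: "l \<in> {1..n}" for l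
  proof -
    have "star A (\<Phi> (t l)) \<otimes> T = T \<otimes> star A (S l)"
    proof (rule eq_on_S)
      fix m assume m: "m \<in> {1..n}"
      have "star A (\<Phi> (t l)) \<otimes> T \<otimes> S m = star A (\<Phi> (t l)) \<otimes> \<Phi> (t m) \<otimes> T"
        using m by (simp add: m_assoc \<Phi>_t_T)
      also have "star A (\<Phi> (t l)) \<otimes> \<Phi> (t m) = \<Phi> (star A (t l) \<otimes> t m)"
        using star_homD(2,5)[OF \<Phi>] by simp
      also have "\<dots> = of_bool (l = m) \<odot> \<one>"
        using l m by (simp add: t.star_S_S star_homD[OF \<Phi>])
      also have "\<dots> \<otimes> T = T \<otimes> star A (S l) \<otimes> S m"
        using l m by (simp add: m_assoc star_S_S)
      finally show "star A (\<Phi> (t l)) \<otimes> T \<otimes> S m = T \<otimes> star A (S l) \<otimes> S m" .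
    qed (use l in auto)
    then show ?thesis using l by (simp add: h_S \<Phi>_t_T)
  qed
  ultimately have "cstar_generated A (S ` {1..n}) \<subseteq> ?E"
    by (intro cstar_generated_least) auto
  then show ?thesis using x gen by auto
qed

end

text \<open>
  The compression \<open>y \<mapsto> T\<^sup>* \<Phi>(y) T\<close> is a contractive left inverse of the homomorphism \<open>h\<close> that maps
  \<open>S l\<close> to \<open>t l\<close>. So \<open>h\<close> is isometric, and its range is closed.
\<close>

lemma embedding:
  assumes cuntz: "cuntz_algebra A n S"
  obtains h where "h \<in> star_hom A A" "inj_on h (carrier A)"
    "h ` carrier A = cstar_generated A (t ` {1..n})"
proof -
  note ax = unital_cstar_algebra_axioms
  have gen: "cstar_generated A (S ` {1..n}) = carrier A"
    and univ: "\<And>R. cuntz_family A n R \<Longrightarrow> \<exists>h\<in>star_hom A A. \<forall>k\<in>{1..n}. h (S k) = R k"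
    using cuntz ax unfolding cuntz_algebra_def by blast+
  obtain h where h: "h \<in> star_hom A A" "\<And>k. k \<in> {1..n} \<Longrightarrow> h (S k) = t k"
    using univ[OF t_family] by blast
  obtain \<Phi> where \<Phi>: "\<Phi> \<in> star_hom A A" "\<And>k. k \<in> {1..n} \<Longrightarrow> \<Phi> (S k) = S k \<otimes> W k"
    using univ[OF W_family] by blast
  have inv: "star A T \<otimes> (\<Phi> (h x) \<otimes> T) = x" if x: "x \<in> carrier A" for x
  proof -
    have "star A T \<otimes> (T \<otimes> x) = x" using x T_isometry by (simp flip: m_assoc)
    then show ?thesis using intertwining[OF \<Phi> gen h x] by simp
  qed
  have below: "cnorm A x \<le> cnorm A (h x)" if x: "x \<in> carrier A" for x
  proof -
    have hx: "h x \<in> carrier A" and \<Phi>hx: "\<Phi> (h x) \<in> carrier A"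
      using x star_homD(1)[OF h(1)] star_homD(1)[OF \<Phi>(1)] by auto
    have T1: "cnorm A T \<le> 1" using T_isometry by (intro norm_isometry_le) auto
    have "cnorm A (star A T \<otimes> (\<Phi> (h x) \<otimes> T)) \<le> cnorm A (star A T) * (cnorm A (\<Phi> (h x)) * cnorm A T)"
      using \<Phi>hx by (intro order_trans[OF norm_mult_le] mult_left_mono norm_mult_le norm_nonneg) auto
    also have "\<dots> \<le> 1 * (cnorm A (h x) * 1)"
      using T1 hx \<Phi>hx star_hom_contractive[OF ax ax \<Phi>(1) hx]
      by (intro mult_mono mult_nonneg_nonneg norm_nonneg) auto
    finally show ?thesis using inv[OF x] by simp
  qed
  have "inj_on h (carrier A)"
    by (rule inj_onI) (metis inv)
  moreover have "h ` carrier A = cstar_generated A (t ` {1..n})"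
  proof
    have "t ` {1..n} \<subseteq> h ` carrier A"
    proof
      fix x assume "x \<in> t ` {1..n}"
      then obtain k where "k \<in> {1..n}" "x = t k" by blast
      then show "x \<in> h ` carrier A" using h(2)[of k] S_closed[of k] by (metis image_eqI)
    qed
    then show "cstar_generated A (t ` {1..n}) \<subseteq> h ` carrier A"
      by (intro cstar_generated_least cstar_subalgebra_range[OF ax ax h(1) below])
    let ?E = "{x \<in> carrier A. h x \<in> cstar_generated A (t ` {1..n})}"
    have "cstar_subalgebra A (cstar_generated A (t ` {1..n}))"
      by (rule cstar_subalgebra_generated) auto
    then have "cstar_subalgebra A ?E"
      by (rule cstar_subalgebra_vimage[OF ax ax h(1)])
    moreover have "S ` {1..n} \<subseteq> ?E"
      using h(2) cstar_generated_superset[of "t ` {1..n}" A] by auto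
    ultimately have "carrier A \<subseteq> ?E"
      unfolding gen[symmetric] by (rule cstar_generated_least)
    then show "h ` carrier A \<subseteq> cstar_generated A (t ` {1..n})" by blast
  qed
  ultimately show thesis using that h(1) by blast
qed

section \<open>The fixed-point algebra of the cyclic automorphism\<close>

context
  fixes \<Lambda> :: "'a \<Rightarrow> 'a"
  assumes \<Lambda>: "\<Lambda> \<in> star_hom A A"
    and \<Lambda>_S: "\<And>k. k \<in> {1..n-1} \<Longrightarrow> \<Lambda> (S k) = S (k + 1)" and \<Lambda>_S_n: "\<Lambda> (S n) = S 1"
begin

text \<open>The phase identity covers the step from \<open>n\<close> to \<open>1\<close> as well, because \<open>e\<close> has period \<open>n\<close>.\<close>

lemma S_eq_\<Lambda>:
  assumes "k \<in> {1..n}"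
  obtains j where "j \<in> {1..n}" "S k = \<Lambda> (S j)" "e (int k) = e 1 * e (int j)"
proof (cases "k = 1")
  case True
  have "n \<in> {1..n}" using n_pos by (simp add: atLeastAtMost_iff)
  moreover have "e (int k) = e 1 * e (int n)" using True by simp
  ultimately show thesis using that[of n] \<Lambda>_S_n True by simp
next
  case False
  then have "k - 1 \<in> {1..n-1}" "k - 1 \<in> {1..n}" "k - 1 + 1 = k"
    using assms by (auto simp: atLeastAtMost_iff)
  moreover have "e (int k) = e 1 * e (int (k - 1))"
    using assms by (simp add: atLeastAtMost_iff flip: unity_root_add)
  ultimately show thesis using that[of "k - 1"] \<Lambda>_S[of "k - 1"] by simp
qed

lemma \<Lambda>_v: "\<Lambda> v = e (-1) \<odot> v"
proof (rule eq_on_S)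
  fix k assume "k \<in> {1..n}"
  then obtain j where j: "j \<in> {1..n}" "S k = \<Lambda> (S j)" "e (int k) = e 1 * e (int j)"
    by (rule S_eq_\<Lambda>)
  have "\<Lambda> v \<otimes> S k = \<Lambda> (v \<otimes> S j)" using j(1) by (simp add: j(2) star_homD(2)[OF \<Lambda>])
  also have "\<dots> = e (int j) \<odot> S k" using j(1) by (simp add: v_S j(2) star_homD(6)[OF \<Lambda>])
  also have "e (int j) = e (-1) * e (int k)"
    unfolding j(3) mult.assoc[symmetric] by (simp flip: unity_root_add)
  also have "(e (-1) * e (int k)) \<odot> S k = e (-1) \<odot> v \<otimes> S k"
    using \<open>k \<in> {1..n}\<close> by (simp add: v_S)
  finally show "\<Lambda> v \<otimes> S k = e (-1) \<odot> v \<otimes> S k" .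
qed (use star_homD(1)[OF \<Lambda>] in auto)

lemma \<Lambda>_T: "\<Lambda> T = T"
proof (rule eq_on_star_S)
  fix k assume k: "k \<in> {1..n}"
  then obtain j where j: "j \<in> {1..n}" "S k = \<Lambda> (S j)"
    by (rule S_eq_\<Lambda>)
  have "star A (S k) \<otimes> \<Lambda> T = \<Lambda> (star A (S j) \<otimes> T)"
    using j(1) by (simp add: j(2) star_homD(2,5)[OF \<Lambda>])
  also have "\<dots> = star A (S k) \<otimes> T"
    using k j(1) by (simp add: star_S_T star_homD(4,6)[OF \<Lambda>])
  finally show "star A (S k) \<otimes> \<Lambda> T = star A (S k) \<otimes> T" .
qed (use star_homD(1)[OF \<Lambda>] in auto)

lemma \<Lambda>_pow_hom: "(\<Lambda> ^^ j) \<in> star_hom A A"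
proof (induct j)
  case 0
  then show ?case using star_hom_id[of A] by (simp add: id_def)
next
  case (Suc j)
  then show ?case using star_hom_compose[OF Suc \<Lambda>] by (simp add: comp_def)
qed

lemma \<Lambda>_pow_v: "(\<Lambda> ^^ j) (v [^] (l::nat)) = e (- (int l * int j)) \<odot> v [^] l"
proof (induct j)
  case (Suc j)
  have "\<Lambda> (v [^] l) = e (- int l) \<odot> v [^] l"
    by (simp add: star_hom_nat_pow[OF unital_cstar_algebra_axioms unital_cstar_algebra_axioms \<Lambda>]
        \<Lambda>_v smult_nat_pow unity_root_power)
  then have "(\<Lambda> ^^ Suc j) (v [^] l) = (e (- (int l * int j)) * e (- int l)) \<odot> v [^] l"
    by (simp add: Suc star_homD(6)[OF \<Lambda>])
  also have "e (- (int l * int j)) * e (- int l) = e (- (int l * int (Suc j)))"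
    by (simp add: algebra_simps flip: unity_root_add)
  finally show ?case .
qed simp

lemma \<Lambda>_t: "\<Lambda> (t l) = t l"
proof -
  have "\<Lambda> (v [^] l) = e (- int l) \<odot> v [^] l" using \<Lambda>_pow_v[of 1 l] by simp
  moreover have "e (int l) * e (- int l) = 1" by (simp flip: unity_root_add)
  ultimately show ?thesis
    by (simp add: Ad_def star_homD[OF \<Lambda>] \<Lambda>_T)
qed

abbreviation B :: "'a set" where "B \<equiv> cstar_generated A (t ` {1..n})"

text \<open>The simplifier must not rewrite the index set \<open>{1..n}\<close> inside \<open>B\<close>.\<close>

declare One_nat_def [simp del]

lemma B_subalgebra: "cstar_subalgebra A B"
  by (rule cstar_subalgebra_generated) auto

lemmas B_intros = cstar_subalgebraD(2-6)[OF B_subalgebra]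

lemma B_closed: "x \<in> B \<Longrightarrow> x \<in> carrier A"
  by (rule cstar_subalgebraD(1)[OF B_subalgebra])

lemma t_in_B: "l \<in> {1..n} \<Longrightarrow> t l \<in> B"
  using cstar_generated_superset[of "t ` {1..n}" A] by blast

lemma B_fixed: "x \<in> B \<Longrightarrow> \<Lambda> x = x"
proof -
  have "B \<subseteq> {x \<in> carrier A. \<Lambda> x = x}"
    by (intro cstar_generated_least
        cstar_subalgebra_equalizer[OF unital_cstar_algebra_axioms unital_cstar_algebra_axioms \<Lambda> star_hom_id])
      (auto simp: \<Lambda>_t)
  then show "x \<in> B \<Longrightarrow> \<Lambda> x = x" by blast
qed

lemma \<Lambda>_pow_fixed: "\<Lambda> x = x \<Longrightarrow> (\<Lambda> ^^ j) x = x"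
  by (induct j) simp_all

lemma one_in_B: "\<one> \<in> B"
proof -
  have "(\<Oplus>k\<in>{1..n}. t k \<otimes> star A (t k)) \<in> B"
    by (intro cstar_subalgebra_finsum[OF B_subalgebra] B_intros t_in_B)
  then show ?thesis using t_family by (simp add: cuntz_family_def)
qed

lemma v_B_star_v:
  assumes "x \<in> B"
  shows "v \<otimes> x \<otimes> star A v \<in> B"
proof -
  have "cstar_subalgebra A {x \<in> carrier A. v \<otimes> x \<otimes> star A v \<in> B}"
    by (rule cstar_subalgebra_vimage[OF unital_cstar_algebra_axioms unital_cstar_algebra_axioms
          conjugation_star_hom B_subalgebra]) simp_all
  moreover have "v \<otimes> t l \<otimes> star A v \<in> B" if l: "l \<in> {1..n}" for l
  proof (cases "l = n")
    case True
    have "t (Suc n) = t 1" by (simp add: Ad_def)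
    then show ?thesis
      using True n_pos t_in_B[of 1] by (simp only: Ad_v_t) (simp add: atLeastAtMost_iff)
  next
    case False
    then show ?thesis
      using l by (simp only: Ad_v_t) (intro t_in_B, simp add: atLeastAtMost_iff)
  qed
  ultimately have "B \<subseteq> {x \<in> carrier A. v \<otimes> x \<otimes> star A v \<in> B}"
    by (intro cstar_generated_least) auto
  then show ?thesis using assms by blast
qed

text \<open>Up to the factor \<open>n\<close>, this is the conditional expectation onto the fixed-point algebra.\<close>

definition orbit_sum :: "'a \<Rightarrow> 'a" where
  "orbit_sum x = (\<Oplus>j\<in>{1..n}. (\<Lambda> ^^ j) x)"

lemmas \<Lambda>_pow = star_homD[OF \<Lambda>_pow_hom]

lemma orbit_sum_closed [simp]: "x \<in> carrier A \<Longrightarrow> orbit_sum x \<in> carrier A"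
  by (auto simp: orbit_sum_def \<Lambda>_pow(1))

lemma orbit_sum_zero: "orbit_sum \<zero> = \<zero>"
  using star_hom_zero[OF unital_cstar_algebra_axioms unital_cstar_algebra_axioms \<Lambda>_pow_hom]
  by (simp add: orbit_sum_def)

lemma orbit_sum_add: "\<lbrakk>x \<in> carrier A; y \<in> carrier A\<rbrakk> \<Longrightarrow> orbit_sum (x \<oplus> y) = orbit_sum x \<oplus> orbit_sum y"
  by (simp add: orbit_sum_def \<Lambda>_pow finsum_addf)

lemma orbit_sum_smult: "x \<in> carrier A \<Longrightarrow> orbit_sum (c \<odot> x) = c \<odot> orbit_sum x"
  by (simp add: orbit_sum_def \<Lambda>_pow smult_finsum)

lemma orbit_sum_tendsto:
  assumes "\<And>m. s m \<in> carrier A" "L \<in> carrier A" "norm_tendsto A s L"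
  shows "norm_tendsto A (\<lambda>m. orbit_sum (s m)) (orbit_sum L)"
  unfolding orbit_sum_def
  by (rule norm_tendsto_finsum)
    (use assms in \<open>auto simp: \<Lambda>_pow(1) intro!: star_hom_norm_tendsto[OF unital_cstar_algebra_axioms
      unital_cstar_algebra_axioms \<Lambda>_pow_hom]\<close>)

lemma orbit_sum_B_mult: "\<lbrakk>b \<in> B; x \<in> carrier A\<rbrakk> \<Longrightarrow> orbit_sum (b \<otimes> x) = b \<otimes> orbit_sum x"
  by (simp add: orbit_sum_def \<Lambda>_pow mult_finsum B_closed \<Lambda>_pow_fixed B_fixed)

lemma orbit_sum_fixed: "\<lbrakk>x \<in> carrier A; \<Lambda> x = x\<rbrakk> \<Longrightarrow> orbit_sum x = of_nat n \<odot> x"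
  using finsum_smult_const[of x "\<lambda>j. 1" "{1..n}"] by (simp add: orbit_sum_def \<Lambda>_pow_fixed)

text \<open>
  \<open>\<Lambda>\<close> multiplies \<open>v\<^sup>l\<close> by \<open>e (- l)\<close>. So the orbit sum vanishes unless \<open>n\<close> divides \<open>l\<close>, in which case
  \<open>v\<^sup>l = 1\<close>.
\<close>

lemma orbit_sum_v_pow: "orbit_sum (v [^] (l::nat)) \<in> B"
proof -
  have "orbit_sum (v [^] l) = (\<Sum>j\<in>{1..n}. e (int j * (- int l))) \<odot> v [^] l"
    unfolding orbit_sum_def \<Lambda>_pow_v by (simp add: finsum_smult_const mult.commute)
  also have "\<dots> \<in> B"
  proof (cases "n dvd l")
    case True
    then obtain q where "l = n * q" ..
    then have "v [^] l = \<one>" using nat_pow_pow[of v n q] by simp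
    then show ?thesis by (simp add: B_intros one_in_B)
  next
    case False
    then have "(\<Sum>j\<in>{1..n}. e (int j * (- int l))) = 0"
      by (subst sum_unity_root[OF n_pos]) simp
    then show ?thesis by (simp only: smult_0 nat_pow_closed v_closed B_intros)
  qed
  finally show ?thesis .
qed

lemma orbit_sum_v_mult:
  assumes x: "x \<in> carrier A"
  shows "orbit_sum (v \<otimes> x \<otimes> v [^] l) = v \<otimes> orbit_sum (x \<otimes> v [^] Suc l) \<otimes> star A v"
proof -
  have "(\<Lambda> ^^ j) (v \<otimes> x \<otimes> v [^] l) = v \<otimes> (\<Lambda> ^^ j) (x \<otimes> v [^] Suc l) \<otimes> star A v" for j
  proof -
    define y where "y = (\<Lambda> ^^ j) x"
    have y: "y \<in> carrier A" using x by (simp add: y_def \<Lambda>_pow(1))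
    have "(\<Lambda> ^^ j) (v \<otimes> x \<otimes> v [^] l)
        = (e (- (int l * int j)) * e (- int j)) \<odot> (v \<otimes> y \<otimes> v [^] l)"
      using x y \<Lambda>_pow_v[of j 1] by (simp add: \<Lambda>_pow \<Lambda>_pow_v mult.commute flip: y_def)
    also have "e (- (int l * int j)) * e (- int j) = e (- (int (Suc l) * int j))"
      by (simp add: algebra_simps flip: unity_root_add)
    also have "e (- (int (Suc l) * int j)) \<odot> (v \<otimes> y \<otimes> v [^] l)
        = v \<otimes> (y \<otimes> (e (- (int (Suc l) * int j)) \<odot> v [^] Suc l)) \<otimes> star A v"
      using y by (simp add: m_assoc)
    also have "\<dots> = v \<otimes> (\<Lambda> ^^ j) (x \<otimes> v [^] Suc l) \<otimes> star A v"
      using x by (simp only: \<Lambda>_pow(2) nat_pow_closed v_closed \<Lambda>_pow_v y_def)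
    finally show ?thesis .
  qed
  then show ?thesis
    using x by (simp add: orbit_sum_def mult_finsum finsum_mult \<Lambda>_pow(1) del: nat_pow_Suc)
qed

text \<open>
  Let \<open>D\<close> consist of the \<open>x\<close> for which the orbit sums of all \<open>x v\<^sup>l\<close> lie in \<open>B\<close>. It is a closed
  subspace and invariant under left multiplication by \<open>B\<close>, whose elements are fixed, and by \<open>v\<close>,
  which normalises \<open>B\<close>. As \<open>v\<close> and \<open>T\<close> generate everything, \<open>D\<close> is a left ideal; it contains the
  unit.
\<close>

lemma orbit_sum_range:
  assumes gen: "cstar_generated A (S ` {1..n}) = carrier A" and x: "x \<in> carrier A"
  shows "orbit_sum x \<in> B"
proof -
  define D where "D = {x \<in> carrier A. \<forall>l::nat. orbit_sum (x \<otimes> v [^] l) \<in> B}"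
  define M where "M = {x \<in> carrier A. \<forall>y\<in>D. x \<otimes> y \<in> D \<and> star A x \<otimes> y \<in> D}"
  have Dc: "D \<subseteq> carrier A" by (auto simp: D_def)
  have M: "cstar_subalgebra A M"
    unfolding M_def
  proof (rule cstar_subalgebra_multiplier[OF Dc])
    show "\<zero> \<in> D" by (simp add: D_def orbit_sum_zero B_intros)
    show "x \<oplus> y \<in> D" if "x \<in> D" "y \<in> D" for x y
      using that by (simp add: D_def l_distr orbit_sum_add B_intros)
    show "c \<odot> x \<in> D" if "x \<in> D" for c x
      using that by (simp add: D_def orbit_sum_smult B_intros)
    show "L \<in> D" if s: "\<And>m. s m \<in> D" and L: "L \<in> carrier A" "norm_tendsto A s L" for s L
    proof -
      have sc: "s m \<in> carrier A" for m using s Dc by blast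
      have "orbit_sum (L \<otimes> v [^] l) \<in> B" for l :: nat
      proof (rule cstar_subalgebraD(7)[OF B_subalgebra])
        show "orbit_sum (s m \<otimes> v [^] l) \<in> B" for m using s by (simp add: D_def)
        show "norm_tendsto A (\<lambda>m. orbit_sum (s m \<otimes> v [^] l)) (orbit_sum (L \<otimes> v [^] l))"
          using sc L by (intro orbit_sum_tendsto norm_tendsto_mult norm_tendsto_const) auto
      qed (use L in auto)
      then show ?thesis using L by (simp add: D_def)
    qed
  qed
  have BD: "b \<otimes> y \<in> D" if "b \<in> B" "y \<in> D" for b y
    using that by (simp add: D_def B_closed m_assoc orbit_sum_B_mult B_intros)
  have vD: "v \<otimes> y \<in> D" if y: "y \<in> D" for y
  proof -
    have "orbit_sum (v \<otimes> y \<otimes> v [^] l) \<in> B" for l :: nat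
    proof -
      have "orbit_sum (y \<otimes> v [^] Suc l) \<in> B" "y \<in> carrier A"
        using y unfolding D_def by blast+
      then show ?thesis by (simp only: orbit_sum_v_mult v_B_star_v)
    qed
    then show ?thesis using y by (simp add: D_def)
  qed
  have vpD: "v [^] j \<otimes> y \<in> D" if y: "y \<in> D" for j :: nat and y
    using y
  proof (induct j arbitrary: y)
    case 0
    then show ?case using Dc by (simp add: subset_iff)
  next
    case (Suc j)
    then show ?case using vD[of y] Dc by (auto simp: m_assoc subset_iff)
  qed
  \<comment> \<open>Thus the invariance under \<open>v\<close> implies that under the adjoint of \<open>v\<close>.\<close>
  have star_v: "star A v = v [^] (n - 1)"
  proof -
    have "v [^] n = v \<otimes> v [^] (n - 1)"
      using nat_pow_Suc2[OF v_closed, of "n - 1"] n_pos by (simp only: Suc_diff_1)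
    then have "v \<otimes> v [^] (n - 1) = \<one>" by (simp only: v_pow_n)
    then have "star A v = star A v \<otimes> (v \<otimes> v [^] (n - 1))"
      by (simp only: r_one star_closed v_closed)
    also have "\<dots> = (star A v \<otimes> v) \<otimes> v [^] (n - 1)"
      by (rule m_assoc[symmetric]) simp_all
    finally show ?thesis by simp
  qed
  have vM: "v \<in> M"
    using vD vpD by (simp add: M_def star_v)
  have T_B: "T \<in> B" using t_in_B[of n] n_pos t_n by (simp only: atLeastAtMost_iff) simp
  then have TM: "T \<in> M"
    using BD B_intros by (simp add: M_def)
  have "v [^] l \<otimes> T \<in> M" for l :: nat
  proof (induct l)
    case (Suc l)
    have "v [^] Suc l \<otimes> T = v \<otimes> (v [^] l \<otimes> T)"
      using nat_pow_Suc2[of v l] by (simp add: m_assoc del: nat_pow_Suc)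
    then show ?case using cstar_subalgebraD(4)[OF M vM Suc] by simp
  qed (simp add: TM)
  then have "S k \<in> M" if "k \<in> {1..n}" for k
    unfolding S_eq_sum[OF that]
    by (intro cstar_subalgebra_finsum[OF M] cstar_subalgebraD(6)[OF M])
  then have "carrier A \<subseteq> M"
    unfolding gen[symmetric] by (intro cstar_generated_least M) auto
  moreover have "\<one> \<in> D" by (simp add: D_def orbit_sum_v_pow)
  ultimately have "x \<otimes> \<one> \<in> D" using x unfolding M_def by blast
  then have "orbit_sum (x \<otimes> \<one> \<otimes> v [^] (0::nat)) \<in> B" unfolding D_def by blast
  then show ?thesis using x by simp
qed

lemma fixed_points_eq:
  assumes gen: "cstar_generated A (S ` {1..n}) = carrier A"
  shows "{x \<in> carrier A. \<Lambda> x = x} = B"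
proof
  show "B \<subseteq> {x \<in> carrier A. \<Lambda> x = x}" using B_closed B_fixed by blast
  show "{x \<in> carrier A. \<Lambda> x = x} \<subseteq> B"
  proof clarify
    fix x assume x: "x \<in> carrier A" "\<Lambda> x = x"
    then have "of_nat n \<odot> x \<in> B" using orbit_sum_range[OF gen x(1)] by (simp add: orbit_sum_fixed)
    then have "(1 / of_nat n) \<odot> (of_nat n \<odot> x) \<in> B" by (rule B_intros)
    then show "x \<in> B" using x n_pos by simp
  qed
qed

end

end

theorem theorem3p1:
  fixes \<O> :: "'a cstar_algebra" and S :: "nat \<Rightarrow> 'a" and n :: nat and \<Lambda> :: "'a \<Rightarrow> 'a"
  assumes "n \<ge> 2"
    and "cuntz_algebra \<O> n S"
    and "cyclic_automorphism \<O> n S \<Lambda>"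
  shows "star_isomorphic (fixed_point_algebra \<O> \<Lambda>) \<O> \<and>
    carrier (fixed_point_algebra \<O> \<Lambda>) =
      cstar_generated \<O>
        {Ad \<O> (cuntz_v \<O> n S [^]\<^bsub>\<O>\<^esub> l) (cuntz_T \<O> n S) | l. l \<in> {0..n-1}}"
proof -
  interpret unital_cstar_algebra \<O>
    using assms(2) by (simp add: cuntz_algebra_def)
  interpret cuntz_generators \<O> n S
    using assms(1,2) by unfold_locales (auto simp: cuntz_algebra_def)
  have gen: "cstar_generated \<O> (S ` {1..n}) = carrier \<O>"
    using assms(2) by (simp add: cuntz_algebra_def)
  have \<Lambda>: "\<Lambda> \<in> star_hom \<O> \<O>" "\<And>k. k \<in> {1..n-1} \<Longrightarrow> \<Lambda> (S k) = S (k + 1)" "\<Lambda> (S n) = S 1"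
    using assms(3) by (auto simp: cyclic_automorphism_def star_iso_def)
  have carrier: "carrier (fixed_point_algebra \<O> \<Lambda>) = cstar_generated \<O> (t ` {1..n})"
    using fixed_points_eq[OF \<Lambda> gen] by (simp add: fixed_point_algebra_def del: One_nat_def)
  obtain h where h: "h \<in> star_hom \<O> \<O>" "inj_on h (carrier \<O>)"
    "h ` carrier \<O> = carrier (fixed_point_algebra \<O> \<Lambda>)"
    using embedding[OF assms(2)] carrier by metis
  define g where "g = inv_into (carrier \<O>) h"
  have gh: "g (h x) = x" if "x \<in> carrier \<O>" for x
    using h(2) that by (simp add: g_def)
  have image: "\<exists>a\<in>carrier \<O>. x = h a" if "x \<in> carrier (fixed_point_algebra \<O> \<Lambda>)" for x
    using that h(3) by blast
  have ops: "x \<otimes>\<^bsub>fixed_point_algebra \<O> \<Lambda>\<^esub> y = x \<otimes>\<^bsub>\<O>\<^esub> y"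
    "x \<oplus>\<^bsub>fixed_point_algebra \<O> \<Lambda>\<^esub> y = x \<oplus>\<^bsub>\<O>\<^esub> y"
    "\<one>\<^bsub>fixed_point_algebra \<O> \<Lambda>\<^esub> = \<one>\<^bsub>\<O>\<^esub>" "star (fixed_point_algebra \<O> \<Lambda>) x = star \<O> x"
    "c \<odot>\<^bsub>fixed_point_algebra \<O> \<Lambda>\<^esub> x = c \<odot>\<^bsub>\<O>\<^esub> x" for x y c
    by (simp_all add: fixed_point_algebra_def)
  note h_ops = star_homD(2,3,5,6)[OF h(1), symmetric]
  have "bij_betw g (carrier (fixed_point_algebra \<O> \<Lambda>)) (carrier \<O>)"
    unfolding g_def using h(2,3) by (intro bij_betw_inv_into) (simp add: bij_betw_def)
  moreover have "g \<in> ring_hom (fixed_point_algebra \<O> \<Lambda>) \<O>"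
  proof (rule ring_hom_memI)
    show "g \<one>\<^bsub>fixed_point_algebra \<O> \<Lambda>\<^esub> = \<one>\<^bsub>\<O>\<^esub>"
      using gh[OF one_closed] star_homD(4)[OF h(1)] by (simp add: ops)
  qed (auto dest!: image simp: ops h_ops gh)
  moreover have "g (star \<O> x) = star \<O> (g x)" "g (c \<odot>\<^bsub>\<O>\<^esub> x) = c \<odot>\<^bsub>\<O>\<^esub> g x"
    if "x \<in> carrier (fixed_point_algebra \<O> \<Lambda>)" for x c
    using image[OF that] by (auto simp: h_ops gh)
  ultimately have "g \<in> star_iso (fixed_point_algebra \<O> \<Lambda>) \<O>"
    by (simp add: star_iso_def star_hom_def ring_iso_def ops)
  then have "star_isomorphic (fixed_point_algebra \<O> \<Lambda>) \<O>"
    by (auto simp: star_isomorphic_def)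
  then show ?thesis using carrier by (simp only: generators_eq)
qed

end
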